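(* Let $\alpha_0,\alpha_1\in C^{\log}_{\mathrm{loc}}(\mathbb{R}^n)$ and $p_0,p_1\in\mathcal{P}^{\log}(\mathbb{R}^n)$. Let $q\in\mathcal{P}(\mathbb{R})$ be log-Hölder continuous at the origin. If $\alpha_0\ge\alpha_1$ and $$\alpha_0(x)-\frac{n}{p_0(x)}=\alpha_1(x)-\frac{n}{p_1(x)}\qquad\text{for all }x\in\mathbb{R}^n,$$ then $$\boldsymbol{B}^{\alpha_0(\cdot)}_{p_0(\cdot),q(\cdot)}\hookrightarrow\boldsymbol{B}^{\alpha_1(\cdot)}_{p_1(\cdot),q(\cdot)}.$$
   Context: $A_1\hookrightarrow A_2$ means $A_1\subset A_2$ and there is $c>0$ with $\|f\|_{A_2}\le c\|f\|_{A_1}$ for all $f\in A_1$. Exponents. $\mathcal{P}(\mathbb{R}^d)$ is the set of measurable functions $\mathbb{R}^d\to[1,\infty)$. For $p\in\mathcal{P}(\mathbb{R}^n)$, $\|f\|_{p(\cdot)}:=\inf\{\lambda>0:\int_{\mathbb{R}^n}|f(x)/\lambda|^{p(x)}dx\le1\}$. For $q\in\mathcal{P}(\mathbb{R})$ and measurable $g$ on an interval $I\subset(0,1]$, $\|g(t)\|_{L^{q(\cdot)}(I,dt/t)}:=\inf\{\lambda>0:\int_I|g(t)/\lambda|^{q(t)}\frac{dt}{t}\le1\}$. Log-Hölder conditions. $g\in C^{\log}_{\mathrm{loc}}(\mathbb{R}^n)$ means $g:\mathbb{R}^n\to\mathbb{R}$ and there is $c_{\log}(g)>0$ with $|g(x)-g(y)|\le\frac{c_{\log}(g)}{\log(e+1/|x-y|)}$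 for all $x,y\in\mathbb{R}^n$. $g$ is log-Hölder continuous at the origin if there is $c>0$ with $|g(x)-g(0)|\le\frac{c}{\log(e+1/|x|)}$ for all $x$. $g\in C^{\log}(\mathbb{R}^n)$ if $g\in C^{\log}_{\mathrm{loc}}(\mathbb{R}^n)$ and there are $g_\infty\in\mathbb{R}$, $c>0$ with $|g(x)-g_\infty|\le\frac{c}{\log(e+|x|)}$ for all $x$. $\mathcal{P}^{\log}(\mathbb{R}^n):=\{p\in\mathcal{P}(\mathbb{R}^n):1/p\in C^{\log}(\mathbb{R}^n)\}$. Resolution of unity. $\mathcal{F}$ is the Fourier transform, normalised so that $\mathcal{F}(f*g)=\mathcal{F}f\,\mathcal{F}g$. A pair $\{\mathcal{F}\Phi,\mathcal{F}\varphi\}$ with $\Phi,\varphi\in\mathcal{S}(\mathbb{R}^n)$ is a resolution of unity if $\operatorname{supp}\mathcal{F}\Phi\subset\{|x|<2\}$, $\operatorname{supp}\mathcal{F}\varphi\subset\{\frac12<|x|<2\}$ and $\mathcal{F}\Phi(\xi)+\int_0^1\mathcal{F}\varphi(t\xi)\frac{dt}{t}=1$ for all $\xi\in\mathbb{R}^n$. Put $\varphi_t:=t^{-n}\varphi(\cdot/t)$. Besov space. Fix a resolution of unity $\{\mathcal{F}\Phi,\mathcal{F}\varphi\}$. $\boldsymbol{B}^{\alpha(\cdot)}_{p(\cdot),q(\cdot)}$ is the set of $f\in\mathcal{S}'(\mathbb{R}^n)$ with $$\|f\|_{\boldsymbol{B}^{\alpha(\cdot)}_{p(\cdot),q(\cdot)}}:=\|\Phi*f\|_{p(\cdot)}+\Big\|\,\|t^{-\alpha(\cdot)}(\varphi_t*f)\|_{p(\cdot)}\Big\|_{L^{q(\cdot)}((0,1],\frac{dt}{t})}<\infty.$$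 *)

theory Defs
  imports "HOL-Analysis.Analysis"
begin

section \<open>Variable exponents and Luxemburg norms\<close>

definition exponents :: "('a::euclidean_space \<Rightarrow> real) set"
  where "exponents = {p \<in> borel_measurable lebesgue. \<forall>x. 1 \<le> p x}"

text \<open>The power of an extended non-negative number, for a positive real exponent.\<close>

definition epowr :: "ennreal \<Rightarrow> real \<Rightarrow> ennreal"
  where "epowr x a = (if x = \<infinity> then \<infinity> else ennreal (enn2real x powr a))"

text \<open>The argument is the modulus of the function. It may be infinite, because in the Besov norm
  the outer norm is applied to an inner norm that may be infinite. The infimum of the empty set
  is \<open>\<infinity>\<close>.\<close>

definition luxemburg_norm :: "'a measure \<Rightarrow> ('a \<Rightarrow> real) \<Rightarrow> ('a \<Rightarrow> ennreal) \<Rightarrow> ennreal"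
  where "luxemburg_norm M p g =
    (INF l \<in> {l::real. 0 < l \<and> (\<integral>\<^sup>+ x. epowr (g x / ennreal l) (p x) \<partial>M) \<le> 1}. ennreal l)"

definition Lp_norm :: "(real^'n \<Rightarrow> real) \<Rightarrow> (real^'n \<Rightarrow> complex) \<Rightarrow> ennreal"
  where "Lp_norm p f = luxemburg_norm lebesgue p (\<lambda>x. ennreal (norm (f x)))"

definition log_measure :: "real measure"
  where "log_measure = density (lebesgue_on {0<..1}) (\<lambda>t. ennreal (1 / t))"

section \<open>Log-Hoelder continuity\<close>

text \<open>At coinciding points the left-hand sides vanish and \<open>1 / 0 = 0\<close> makes the right-hand
  sides positive, so these instances are trivially true.\<close>

definition C_log_loc :: "('a::euclidean_space \<Rightarrow> real) set"
  where "C_log_loc = {g. \<exists>c>0. \<forall>x y. \<bar>g x - g y\<bar> \<le> c / ln (exp 1 + 1 / norm (x - y))}"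

definition log_holder_at_origin :: "('a::euclidean_space \<Rightarrow> real) \<Rightarrow> bool"
  where "log_holder_at_origin g \<longleftrightarrow>
    (\<exists>c>0. \<forall>x. \<bar>g x - g 0\<bar> \<le> c / ln (exp 1 + 1 / norm x))"

definition C_log :: "('a::euclidean_space \<Rightarrow> real) set"
  where "C_log = {g \<in> C_log_loc. \<exists>L. \<exists>c>0. \<forall>x. \<bar>g x - L\<bar> \<le> c / ln (exp 1 + norm x)}"

definition log_exponents :: "('a::euclidean_space \<Rightarrow> real) set"
  where "log_exponents = {p \<in> exponents. (\<lambda>x. 1 / p x) \<in> C_log}"

section \<open>Schwartz functions and tempered distributions\<close>

definition partial_deriv :: "'n \<Rightarrow> (real^'n \<Rightarrow> complex) \<Rightarrow> real^'n \<Rightarrow> complex"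
  where "partial_deriv i f x = frechet_derivative f (at x) (axis i 1)"

primrec iter_partial :: "'n list \<Rightarrow> (real^'n \<Rightarrow> complex) \<Rightarrow> real^'n \<Rightarrow> complex"
  where
    "iter_partial [] f = f"
  | "iter_partial (i # is) f = partial_deriv i (iter_partial is f)"

definition smooth :: "(real^'n \<Rightarrow> complex) \<Rightarrow> bool"
  where "smooth f \<longleftrightarrow> (\<forall>is x. iter_partial is f differentiable (at x))"

definition schwartz :: "(real^'n \<Rightarrow> complex) set"
  where "schwartz = {f. smooth f \<and>
    (\<forall>k is. bdd_above (range (\<lambda>x. (1 + norm x) ^ k * norm (iter_partial is f x))))}"

definition schwartz_seminorm :: "nat \<Rightarrow> 'n list \<Rightarrow> (real^'n \<Rightarrow> complex) \<Rightarrow> real"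
  where "schwartz_seminorm k is f = (SUP x. (1 + norm x) ^ k * norm (iter_partial is f x))"

text \<open>Complex-linear functionals that are continuous for the topology given by the seminorms.
  A functional is \<^const>\<open>undefined\<close> off \<open>schwartz\<close>, so that equality of distributions is
  equality of functionals on \<open>schwartz\<close>.\<close>

definition tempered :: "((real^'n \<Rightarrow> complex) \<Rightarrow> complex) set"
  where "tempered = {T \<in> extensional schwartz.
    (\<forall>f\<in>schwartz. \<forall>g\<in>schwartz. T (\<lambda>x. f x + g x) = T f + T g) \<and>
    (\<forall>c. \<forall>f\<in>schwartz. T (\<lambda>x. c * f x) = c * T f) \<and>
    (\<exists>C N. \<forall>f\<in>schwartz.
       norm (T f) \<le> C * (\<Sum>is | length is \<le> N. schwartz_seminorm N is f))}"

definition conv :: "(real^'n \<Rightarrow> complex) \<Rightarrow> ((real^'n \<Rightarrow> complex) \<Rightarrow> complex) \<Rightarrow> real^'n \<Rightarrow> complex"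
  where "conv \<phi> T x = T (\<lambda>y. \<phi> (x - y))"

section \<open>Resolutions of unity\<close>

text \<open>Without a prefactor, so that convolutions go to products.\<close>

definition fourier :: "(real^'n \<Rightarrow> complex) \<Rightarrow> real^'n \<Rightarrow> complex"
  where "fourier f \<xi> = (LINT x|lborel. exp (- (\<i> * of_real (x \<bullet> \<xi>))) * f x)"

definition supp :: "(real^'n \<Rightarrow> complex) \<Rightarrow> (real^'n) set"
  where "supp f = closure {x. f x \<noteq> 0}"

definition resolution_of_unity :: "(real^'n \<Rightarrow> complex) \<Rightarrow> (real^'n \<Rightarrow> complex) \<Rightarrow> bool"
  where "resolution_of_unity \<Phi> \<phi> \<longleftrightarrow>
    \<Phi> \<in> schwartz \<and> \<phi> \<in> schwartz \<and>
    supp (fourier \<Phi>) \<subseteq> {\<xi>. norm \<xi> < 2} \<and>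
    supp (fourier \<phi>) \<subseteq> {\<xi>. 1 / 2 < norm \<xi> \<and> norm \<xi> < 2} \<and>
    (\<forall>\<xi>. fourier \<Phi> \<xi> + (LINT t:{0<..1}|lborel. (1 / t) *\<^sub>R fourier \<phi> (t *\<^sub>R \<xi>)) = 1)"

definition dilate :: "real \<Rightarrow> (real^'n \<Rightarrow> complex) \<Rightarrow> real^'n \<Rightarrow> complex"
  where "dilate t \<phi> x = (1 / t ^ CARD('n)) *\<^sub>R \<phi> (x /\<^sub>R t)"

section \<open>Besov spaces of variable smoothness and integrability\<close>

definition besov_norm ::
  "(real^'n \<Rightarrow> complex) \<Rightarrow> (real^'n \<Rightarrow> complex) \<Rightarrow>
   (real^'n \<Rightarrow> real) \<Rightarrow> (real^'n \<Rightarrow> real) \<Rightarrow> (real \<Rightarrow> real) \<Rightarrow>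
   ((real^'n \<Rightarrow> complex) \<Rightarrow> complex) \<Rightarrow> ennreal"
  where "besov_norm \<Phi> \<phi> \<alpha> p q f =
    Lp_norm p (conv \<Phi> f) +
    luxemburg_norm log_measure q
      (\<lambda>t. Lp_norm p (\<lambda>x. (t powr (- \<alpha> x)) *\<^sub>R conv (dilate t \<phi>) f x))"

definition besov_space ::
  "(real^'n \<Rightarrow> complex) \<Rightarrow> (real^'n \<Rightarrow> complex) \<Rightarrow>
   (real^'n \<Rightarrow> real) \<Rightarrow> (real^'n \<Rightarrow> real) \<Rightarrow> (real \<Rightarrow> real) \<Rightarrow>
   ((real^'n \<Rightarrow> complex) \<Rightarrow> complex) set"
  where "besov_space \<Phi> \<phi> \<alpha> p q = {f \<in> tempered. besov_norm \<Phi> \<phi> \<alpha> p q f < \<infinity>}"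

definition embeds :: "'b set \<Rightarrow> ('b \<Rightarrow> ennreal) \<Rightarrow> 'b set \<Rightarrow> ('b \<Rightarrow> ennreal) \<Rightarrow> bool"
  where "embeds A\<^sub>1 N\<^sub>1 A\<^sub>2 N\<^sub>2 \<longleftrightarrow>
    A\<^sub>1 \<subseteq> A\<^sub>2 \<and> (\<exists>c::real. 0 < c \<and> (\<forall>f\<in>A\<^sub>1. N\<^sub>2 f \<le> ennreal c * N\<^sub>1 f))"

end

theory Submission
  imports Defs "HOL-Probability.Probability" "HOL-Real_Asymp.Real_Asymp"
begin

text \<open>The embedding holds for each dilation parameter \<open>t\<close> separately, by a Nikolskii inequality with
  constants independent of \<open>t\<close>. The Fourier transform of \<open>\<Phi>\<close> is \<open>1\<close> on the ball of radius
  \<open>1 / 2\<close>, hence \<open>g = dilate t \<phi> * f\<close> satisfies \<open>g = dilate (t / 4) \<Phi> * g\<close>. With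
  \<open>\<beta> = \<alpha>\<^sub>0 - n / p\<^sub>0 = \<alpha>\<^sub>1 - n / p\<^sub>1\<close> and \<open>w = t powr (- \<beta>) * \<bar>g\<bar>\<close>, local log-Hoelder continuity moves the
  weight inside this convolution at the cost of a polynomial factor. If the \<open>p\<^sub>0\<close>-modular of
  \<open>t powr (- \<alpha>\<^sub>0) * \<bar>g\<bar>\<close> is at most \<open>1\<close>, the integral of \<open>w powr p\<^sub>0\<close> is at most \<open>t ^ n\<close>, and
  \<open>w \<le> 1 + w powr p\<^sub>0\<close> gives a uniform bound \<open>w \<le> A\<close>. As \<open>p\<^sub>0 \<le> p\<^sub>1\<close>, it follows that
  \<open>(t powr (- \<alpha>\<^sub>1) * \<bar>g\<bar> / A) powr p\<^sub>1 = t powr (- n) * (w / A) powr p\<^sub>1 \<le> t powr (- n) * w powr p\<^sub>0\<close>, which is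
  \<open>(t powr (- \<alpha>\<^sub>0) * \<bar>g\<bar>) powr p\<^sub>0\<close>. The outer norm is monotone and homogeneous.\<close>

section \<open>Integration and Gaussians on Euclidean space\<close>

lemma nn_integral_lborel_affine:
  fixes f :: "'a::euclidean_space \<Rightarrow> ennreal"
  assumes [measurable]: "f \<in> borel_measurable borel" and c: "c \<noteq> 0"
  shows "(\<integral>\<^sup>+x. f x \<partial>lborel) = ennreal (\<bar>c\<bar> ^ DIM('a)) * (\<integral>\<^sup>+x. f (a + c *\<^sub>R x) \<partial>lborel)"
  by (subst lborel_affine[OF c, of a])
    (simp add: nn_integral_density nn_integral_distr nn_integral_cmult ennreal_power)

lemma integrable_lborel_affine:
  fixes f :: "'a::euclidean_space \<Rightarrow> 'b::{banach, second_countable_topology}"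
  assumes f: "integrable lborel f" and c: "c \<noteq> 0"
  shows "integrable lborel (\<lambda>x. f (a + c *\<^sub>R x))"
proof -
  have [measurable]: "f \<in> borel_measurable borel" using f by auto
  have "(\<integral>\<^sup>+x. norm (f x) \<partial>lborel) < \<infinity>" using f by (simp add: integrable_iff_bounded)
  then have "(\<integral>\<^sup>+x. norm (f (a + c *\<^sub>R x)) \<partial>lborel) < \<infinity>"
    by (subst (asm) nn_integral_lborel_affine[OF _ c, where a=a])
      (use c in \<open>auto simp: ennreal_mult_less_top\<close>)
  then show ?thesis by (simp add: integrable_iff_bounded)
qed

lemma integral_lborel_affine:
  fixes f :: "'a::euclidean_space \<Rightarrow> 'b::{banach, second_countable_topology}"
  assumes [measurable]: "f \<in> borel_measurable borel" and c: "c \<noteq> 0"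
  shows "(LINT x|lborel. f x) = \<bar>c\<bar> ^ DIM('a) *\<^sub>R (LINT x|lborel. f (a + c *\<^sub>R x))"
  by (subst lborel_affine[OF c, of a])
    (simp add: integral_density integral_distr ennreal_power del: ennreal_power[symmetric])

lemma integrable_lborel_prod:
  fixes f :: "real \<Rightarrow> real"
  assumes f: "integrable lborel f" and nn: "\<And>x. 0 \<le> f x"
  shows "integrable lborel (\<lambda>x::'a::euclidean_space. \<Prod>b\<in>Basis. f (x \<bullet> b))"
proof -
  have [measurable]: "f \<in> borel_measurable borel" using f by auto
  have "(\<integral>\<^sup>+x. f x \<partial>lborel) < \<infinity>" using f nn by (simp add: integrable_iff_bounded)
  then have "(\<integral>\<^sup>+x. (\<Prod>b\<in>Basis. ennreal (f ((x::'a) \<bullet> b))) \<partial>lborel) < \<infinity>"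
    by (subst nn_integral_lborel_prod) (auto simp: nn power_less_top_ennreal)
  then show ?thesis
    by (intro integrableI_nonneg) (auto intro!: prod_nonneg nn simp: prod_ennreal nn)
qed

lemma integrable_inverse_one_plus_square: "integrable lborel (\<lambda>x::real. inverse (1 + x\<^sup>2))"
proof -
  have "set_integrable lborel (einterval (-\<infinity>) \<infinity>) (\<lambda>x::real. inverse (1 + x\<^sup>2))"
  proof (rule interval_integral_FTC_nonneg(1))
    show "((arctan \<circ> real_of_ereal) \<longlongrightarrow> -(pi/2)) (at_right (-\<infinity>))"
      "((arctan \<circ> real_of_ereal) \<longlongrightarrow> pi/2) (at_left \<infinity>)"
      by (simp_all add: ereal_tendsto_simps tendsto_arctan_at_bot tendsto_arctan_at_top)
    show "DERIV arctan x :> inverse (1 + x\<^sup>2)" for x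
      by (rule DERIV_arctan)
    show "isCont (\<lambda>x::real. inverse (1 + x\<^sup>2)) x" for x
      using sum_power2_gt_zero_iff[of 1 x] by (intro continuous_intros) (auto simp: add_nonneg_eq_0_iff)
  qed (auto)
  then show ?thesis by (simp add: set_integrable_def)
qed

text \<open>Two powers of \<open>1 + norm x\<close> for each coordinate dominate one factor
  \<open>1 + (x \<bullet> b)\<^sup>2\<close> each, so a product of integrable functions of one
  variable is a majorant. The exponent is not sharp, but Schwartz functions decay to any
  order.\<close>

lemma integrable_one_plus_norm_power:
  "integrable lborel (\<lambda>x::'a::euclidean_space. inverse ((1 + norm x) ^ (2 * DIM('a))))"
proof (rule Bochner_Integration.integrable_bound)
  show "integrable lborel (\<lambda>x::'a. \<Prod>b\<in>Basis. inverse (1 + (x \<bullet> b)\<^sup>2))"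
    by (rule integrable_lborel_prod[OF integrable_inverse_one_plus_square]) (auto intro: add_nonneg_nonneg)
  have "inverse ((1 + norm x) ^ (2 * DIM('a))) \<le> (\<Prod>b\<in>Basis. inverse (1 + (x \<bullet> b)\<^sup>2))" for x :: 'a
  proof -
    have le: "inverse ((1 + norm x)\<^sup>2) \<le> inverse (1 + (x \<bullet> b)\<^sup>2)" if "b \<in> Basis" for b
    proof (rule le_imp_inverse_le)
      have "\<bar>x \<bullet> b\<bar> \<le> norm x" using Basis_le_norm[OF that] .
      then have "(x \<bullet> b)\<^sup>2 \<le> (norm x)\<^sup>2" by (rule abs_le_square_iff[THEN iffD1, of "x \<bullet> b" "norm x", simplified])
      then show "1 + (x \<bullet> b)\<^sup>2 \<le> (1 + norm x)\<^sup>2" by (simp add: power2_sum add_increasing2)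
    qed (auto simp: add_pos_nonneg)
    have "inverse ((1 + norm x) ^ (2 * DIM('a))) = (\<Prod>b\<in>(Basis::'a set). inverse ((1 + norm x)\<^sup>2))"
      by (simp add: power_mult power_inverse)
    also have "\<dots> \<le> (\<Prod>b\<in>Basis. inverse (1 + (x \<bullet> b)\<^sup>2))"
      by (rule prod_mono) (use le in auto)
    finally show ?thesis .
  qed
  then show "AE x in lborel. norm (inverse ((1 + norm (x::'a)) ^ (2 * DIM('a))))
      \<le> norm (\<Prod>b\<in>Basis. inverse (1 + (x \<bullet> b)\<^sup>2))"
    by (intro AE_I2) (auto intro!: order_trans[OF _ abs_ge_self])
qed (auto)

text \<open>Without a normalising constant this is exactly the characteristic function of the
  standard normal distribution; of its integral only positivity is used.\<close>

definition gauss :: "'a::euclidean_space \<Rightarrow> real" where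
  "gauss x = exp (- (norm x)\<^sup>2 / 2)"

lemma gauss_prod: "gauss x = (\<Prod>b\<in>Basis. exp (- (x \<bullet> b)\<^sup>2 / 2))"
proof -
  have "(norm x)\<^sup>2 = (\<Sum>b\<in>Basis. (x \<bullet> b)\<^sup>2)"
    unfolding power2_norm_eq_inner euclidean_inner[of x x] by (simp add: power2_eq_square)
  then show ?thesis
    by (simp add: gauss_def exp_sum[symmetric] sum_negf sum_divide_distrib)
qed

lemma integrable_gauss: "integrable lborel (gauss :: 'a::euclidean_space \<Rightarrow> real)"
proof -
  have "integrable lborel (\<lambda>x::real. exp (- x\<^sup>2 / 2))"
  proof -
    have "integrable lborel (\<lambda>x. sqrt (2 * pi) * std_normal_density x)"
      by (intro integrable_mult_right integrable_normal_density) simp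
    then show ?thesis by (simp add: std_normal_density_def)
  qed
  then show ?thesis
    unfolding gauss_prod[abs_def] by (rule integrable_lborel_prod) simp
qed

lemma integral_gauss_pos: "0 < (LINT x|lborel. gauss (x::'a::euclidean_space))"
proof -
  have "(LINT x|lborel. gauss (x::'a)) \<noteq> 0"
  proof
    assume "(LINT x|lborel. gauss (x::'a)) = 0"
    then have "AE x in lborel. gauss (x::'a) = 0"
      by (subst (asm) integral_nonneg_eq_0_iff_AE[OF integrable_gauss]) (auto simp: gauss_def)
    then have "AE x in (lborel :: 'a measure). False" by (simp add: gauss_def)
    then show False by (simp add: AE_iff_null null_sets_def emeasure_lborel_UNIV)
  qed
  moreover have "0 \<le> (LINT x|lborel. gauss (x::'a))" by (auto simp: gauss_def)
  ultimately show ?thesis by linarith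
qed

section \<open>Injectivity of the Fourier transform\<close>

text \<open>In each coordinate this is the characteristic function of the standard normal
  distribution. With the Gaussian written as an average of characters over a probability measure, a
  Gaussian integral becomes an average of Fourier integrals.\<close>

lemma gauss_char:
  fixes x :: "'a::euclidean_space"
  shows "complex_of_real (gauss x) =
    (LINT y|Pi\<^sub>M Basis (\<lambda>_. std_normal_distribution). exp (\<i> * of_real (x \<bullet> (\<Sum>b\<in>Basis. y b *\<^sub>R b))))"
proof -
  interpret N: prob_space std_normal_distribution
    by (rule prob_space_normal_density) simp
  interpret P: product_sigma_finite "\<lambda>_::'a. std_normal_distribution"
    by standard
  have ch: "(LINT y|std_normal_distribution. iexp (t * y)) = exp (- (t\<^sup>2) / 2)" for t
    using fun_cong[OF char_std_normal_distribution, of t] by (simp add: char_def)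
  have "complex_of_real (gauss x) = (\<Prod>b\<in>Basis. LINT y|std_normal_distribution. iexp (x \<bullet> b * y))"
    unfolding ch gauss_prod by simp
  also have "\<dots> = (LINT y|Pi\<^sub>M Basis (\<lambda>_. std_normal_distribution). (\<Prod>b\<in>Basis. iexp (x \<bullet> b * y b)))"
    by (rule P.product_integral_prod[symmetric]) (auto intro!: N.integrable_const_bound[of _ 1])
  also have "\<dots> = (LINT y|Pi\<^sub>M Basis (\<lambda>_. std_normal_distribution). exp (\<i> * of_real (x \<bullet> (\<Sum>b\<in>Basis. y b *\<^sub>R b))))"
    by (simp add: exp_sum[symmetric] inner_sum_right sum_distrib_left mult_ac)
  finally show ?thesis .
qed

text \<open>Insert \<open>gauss_char\<close> and exchange the integrals: the integral over
  \<open>x\<close> is a value of \<open>fourier k\<close>, at minus the frequency because of the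
  sign in \<open>fourier\<close>. The exchange is allowed since characters have modulus 1 and the
  Gaussian measure has mass 1.\<close>

lemma gauss_integral_eq_0:
  fixes k :: "real^'n \<Rightarrow> complex"
  assumes k: "integrable lborel k" and 0: "\<And>\<xi>. fourier k \<xi> = 0"
  shows "(LINT x|lborel. of_real (gauss x) * k x) = 0"
proof -
  let ?M = "Pi\<^sub>M (Basis::(real^'n) set) (\<lambda>_. std_normal_distribution)"
  let ?\<xi> = "\<lambda>y::real^'n \<Rightarrow> real. \<Sum>b\<in>Basis. y b *\<^sub>R b"
  interpret N: prob_space std_normal_distribution
    by (rule prob_space_normal_density) simp
  interpret P: prob_space ?M
    by (rule prob_space_PiM) (rule N.prob_space_axioms)
  interpret L: pair_sigma_finite "lborel :: (real^'n) measure" ?M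
    by standard
  have [measurable]: "k \<in> borel_measurable borel" using k by auto
  have [measurable]: "(\<lambda>y. ?\<xi> y) \<in> borel_measurable ?M"
    by (intro borel_measurable_sum borel_measurable_scaleR) auto
  let ?f = "\<lambda>x y. exp (\<i> * of_real (x \<bullet> ?\<xi> y)) * k x"
  have norm_f: "norm (?f x y) = norm (k x)" for x y by (simp add: norm_mult)
  have int: "integrable (lborel \<Otimes>\<^sub>M ?M) (\<lambda>(x, y). ?f x y)"
  proof (rule L.Fubini_integrable)
    show "(\<lambda>(x, y). ?f x y) \<in> borel_measurable (lborel \<Otimes>\<^sub>M ?M)"
      by measurable
    show "integrable lborel (\<lambda>x. LINT y|?M. norm (case (x, y) of (x, y) \<Rightarrow> ?f x y))"
      using k by (simp add: norm_f P.prob_space)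
    show "AE x in lborel. integrable ?M (\<lambda>y. case (x, y) of (x, y) \<Rightarrow> ?f x y)"
      by (auto intro!: AE_I2 P.integrable_const_bound[of _ "norm (k _)"] simp: norm_mult)
  qed
  have "(LINT x|lborel. of_real (gauss x) * k x) = (LINT x|lborel. LINT y|?M. ?f x y)"
    by (simp add: gauss_char)
  also have "\<dots> = (LINT y|?M. LINT x|lborel. ?f x y)"
    by (rule L.Fubini_integral[symmetric, OF int])
  also have "\<dots> = (LINT y|?M. fourier k (- ?\<xi> y))"
    by (simp add: fourier_def)
  finally show ?thesis by (simp add: 0)
qed

text \<open>The substitution produces a phase and a rescaled frequency, so a vanishing transform
  survives recentring at \<open>a\<close> and zooming in by \<sigma>.\<close>

lemma fourier_affine_eq_0:
  fixes k :: "real^'n \<Rightarrow> complex"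
  assumes k: "integrable lborel k" and 0: "\<And>\<xi>. fourier k \<xi> = 0" and \<sigma>: "\<sigma> \<noteq> 0"
  shows "fourier (\<lambda>x. k (a + \<sigma> *\<^sub>R x)) \<xi> = 0"
proof -
  have [measurable]: "k \<in> borel_measurable borel" using k by auto
  let ?c = "exp (- (\<i> * of_real (a \<bullet> (\<xi> /\<^sub>R \<sigma>))))"
  have "0 = fourier k (\<xi> /\<^sub>R \<sigma>)" by (simp add: 0)
  also have "\<dots> = \<bar>\<sigma>\<bar> ^ DIM(real^'n) *\<^sub>R
      (LINT x|lborel. exp (- (\<i> * of_real ((a + \<sigma> *\<^sub>R x) \<bullet> (\<xi> /\<^sub>R \<sigma>)))) * k (a + \<sigma> *\<^sub>R x))"
    unfolding fourier_def by (rule integral_lborel_affine[OF _ \<sigma>]) measurable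
  also have "(\<lambda>x. exp (- (\<i> * of_real ((a + \<sigma> *\<^sub>R x) \<bullet> (\<xi> /\<^sub>R \<sigma>)))) * k (a + \<sigma> *\<^sub>R x)) =
      (\<lambda>x. ?c * (exp (- (\<i> * of_real (x \<bullet> \<xi>))) * k (a + \<sigma> *\<^sub>R x)))"
  proof
    fix x
    have "(a + \<sigma> *\<^sub>R x) \<bullet> (\<xi> /\<^sub>R \<sigma>) = a \<bullet> (\<xi> /\<^sub>R \<sigma>) + x \<bullet> \<xi>"
      using \<sigma> by (simp add: inner_add_left distrib_left)
    then show "exp (- (\<i> * of_real ((a + \<sigma> *\<^sub>R x) \<bullet> (\<xi> /\<^sub>R \<sigma>)))) * k (a + \<sigma> *\<^sub>R x) =
        ?c * (exp (- (\<i> * of_real (x \<bullet> \<xi>))) * k (a + \<sigma> *\<^sub>R x))"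
      by (simp only:) (simp add: exp_add[symmetric] distrib_left)
  qed
  also have "(LINT x|lborel. ?c * (exp (- (\<i> * of_real (x \<bullet> \<xi>))) * k (a + \<sigma> *\<^sub>R x))) =
      ?c * fourier (\<lambda>x. k (a + \<sigma> *\<^sub>R x)) \<xi>"
    unfolding fourier_def by (rule integral_mult_right_zero)
  finally show ?thesis using \<sigma> by simp
qed

text \<open>The Gaussian averages of \<open>k\<close> around \<open>a\<close> at scale
  \<open>1 / (i + 1)\<close> all vanish. By continuity at \<open>a\<close> and boundedness they tend
  to \<open>k a\<close> times the positive Gaussian mass.\<close>

lemma fourier_eq_0_imp_eq_0:
  fixes k :: "real^'n \<Rightarrow> complex"
  assumes k: "integrable lborel k" and 0: "\<And>\<xi>. fourier k \<xi> = 0"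
    and cont: "isCont k a" and bdd: "\<And>x. norm (k x) \<le> B"
  shows "k a = 0"
proof -
  have [measurable]: "k \<in> borel_measurable borel" using k by auto
  have [measurable]: "gauss \<in> borel_measurable (borel :: (real^'n) measure)"
    using borel_measurable_integrable[OF integrable_gauss] by simp
  let ?s = "\<lambda>i x. of_real (gauss x) * k (a + inverse (real (Suc i)) *\<^sub>R x)"
  have "(\<lambda>i. LINT x|lborel. ?s i x) \<longlonglongrightarrow> (LINT x::real^'n|lborel. of_real (gauss x) * k a)"
  proof (rule integral_dominated_convergence[where w="\<lambda>x. gauss x * B"])
    show "integrable lborel (\<lambda>x::real^'n. gauss x * B)"
      by (rule integrable_mult_left[OF integrable_gauss])
    show "?s i \<in> borel_measurable lborel" for i
      by measurable
    show "AE x in lborel. norm (?s i x) \<le> gauss x * B" for i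
      by (intro AE_I2) (simp add: norm_mult gauss_def bdd mult_left_mono)
    show "AE x in lborel. (\<lambda>i. ?s i x) \<longlonglongrightarrow> of_real (gauss x) * k a"
    proof (intro AE_I2 tendsto_mult tendsto_const)
      fix x :: "real^'n"
      have "(\<lambda>i. a + inverse (real (Suc i)) *\<^sub>R x) \<longlonglongrightarrow> a + 0 *\<^sub>R x"
        by (intro tendsto_intros LIMSEQ_inverse_real_of_nat)
      then show "(\<lambda>i. k (a + inverse (real (Suc i)) *\<^sub>R x)) \<longlonglongrightarrow> k a"
        by (intro isCont_tendsto_compose[OF cont]) simp
    qed
  qed measurable
  moreover have "(LINT x|lborel. ?s i x) = 0" for i
    by (rule gauss_integral_eq_0[OF integrable_lborel_affine[OF k]
          fourier_affine_eq_0[OF k 0]]) auto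
  ultimately have "(LINT x|lborel. of_real (gauss (x::real^'n)) * k a) = 0"
    by (simp add: LIMSEQ_const_iff)
  then have "of_real (LINT x|lborel. gauss (x::real^'n)) * k a = 0"
    by simp
  then show ?thesis using integral_gauss_pos[where 'a="real^'n"] by auto
qed

section \<open>Schwartz functions\<close>

lemma iter_partial_append: "iter_partial (is @ js) f = iter_partial is (iter_partial js f)"
  by (induction "is") simp_all

lemma schwartz_iter_partial: "f \<in> schwartz \<Longrightarrow> iter_partial is f \<in> schwartz"
  by (auto simp: schwartz_def smooth_def iter_partial_append[symmetric])

lemma schwartz_partial_deriv: "f \<in> schwartz \<Longrightarrow> partial_deriv i f \<in> schwartz"
  using schwartz_iter_partial[of f "[i]"] by simp

lemma schwartz_bound:
  assumes "f \<in> schwartz"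
  obtains C where "0 \<le> C" "\<And>x. (1 + norm x) ^ k * norm (f x) \<le> C"
proof -
  have "bdd_above (range (\<lambda>x. (1 + norm x) ^ k * norm (iter_partial [] f x)))"
    using assms by (simp only: schwartz_def mem_Collect_eq)
  then obtain C where C: "\<And>x. (1 + norm x) ^ k * norm (f x) \<le> C"
    by (auto simp: bdd_above_def)
  moreover have "0 \<le> C" by (rule order_trans[OF _ C[of 0]]) simp
  ultimately show ?thesis using that by blast
qed

lemma schwartz_bounded:
  assumes "f \<in> schwartz"
  obtains C where "0 \<le> C" "\<And>x. norm (f x) \<le> C"
  using schwartz_bound[OF assms, of 0] by auto

lemma schwartz_differentiable: "f \<in> schwartz \<Longrightarrow> f differentiable (at x)"
  by (auto simp: schwartz_def smooth_def dest: spec[of _ "[]"])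

lemma schwartz_isCont: "f \<in> schwartz \<Longrightarrow> isCont f x"
  by (rule differentiable_imp_continuous_within[OF schwartz_differentiable])

lemma schwartz_measurable: "f \<in> schwartz \<Longrightarrow> f \<in> borel_measurable borel"
  by (intro borel_measurable_continuous_onI continuous_at_imp_continuous_on ballI schwartz_isCont)

lemma schwartz_has_derivative:
  "f \<in> schwartz \<Longrightarrow> (f has_derivative frechet_derivative f (at x)) (at x)"
  using schwartz_differentiable frechet_derivative_works by blast

lemma frechet_derivative_partial:
  assumes "f differentiable (at x)"
  shows "frechet_derivative f (at x) h = (\<Sum>i\<in>UNIV. h $ i *\<^sub>R partial_deriv i f x)"
proof -
  have lin: "linear (frechet_derivative f (at x))"
    using assms by (rule linear_frechet_derivative)
  have "frechet_derivative f (at x) h = frechet_derivative f (at x) (\<Sum>i\<in>UNIV. h $ i *\<^sub>R axis i 1)"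
    by (simp add: basis_expansion flip: scalar_mult_eq_scaleR)
  then show ?thesis
    by (simp add: linear_sum[OF lin] linear_cmul[OF lin] partial_deriv_def)
qed

lemma partial_deriv_eqI: "(f has_derivative f') (at x) \<Longrightarrow> partial_deriv i f x = f' (axis i 1)"
  unfolding partial_deriv_def by (subst frechet_derivative_at[symmetric]) auto

lemma schwartz_weighted_integrable:
  fixes f :: "real^'n \<Rightarrow> complex"
  assumes f: "f \<in> schwartz"
  shows "integrable lborel (\<lambda>x. (1 + norm x) ^ k * norm (f x))"
proof -
  \<comment> \<open>These extra powers of decay leave the integrable factor of
    \<open>integrable_one_plus_norm_power\<close>.\<close>
  let ?m = "2 * DIM(real^'n)"
  obtain C where C: "0 \<le> C" "\<And>x. (1 + norm x) ^ (k + ?m) * norm (f x) \<le> C"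
    using schwartz_bound[OF f] by blast
  note [measurable] = f[THEN schwartz_measurable]
  show ?thesis
  proof (rule Bochner_Integration.integrable_bound)
    show "integrable lborel (\<lambda>x::real^'n. C * inverse ((1 + norm x) ^ ?m))"
      by (rule integrable_mult_right[OF integrable_one_plus_norm_power])
    have "(1 + norm x) ^ k * norm (f x) \<le> C * inverse ((1 + norm x) ^ ?m)" for x
      using C(2)[of x] by (simp add: power_add field_simps add_pos_nonneg)
    then show "AE x in lborel. norm ((1 + norm x) ^ k * norm (f x)) \<le> norm (C * inverse ((1 + norm x) ^ ?m))"
      using C(1) by (intro AE_I2) (simp add: abs_mult)
  qed measurable
qed

lemma schwartz_integrable:
  fixes f :: "real^'n \<Rightarrow> complex"
  assumes f: "f \<in> schwartz"
  shows "integrable lborel f"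
proof -
  note [measurable] = f[THEN schwartz_measurable]
  have "integrable lborel (\<lambda>x. norm (f x))"
    using schwartz_weighted_integrable[OF f, of 0] by simp
  then show ?thesis by (rule integrable_norm_cancel) measurable
qed

section \<open>Affine substitutions and finite sums of Schwartz functions\<close>

lemma has_derivative_affine:
  fixes f :: "real^'n \<Rightarrow> complex"
  assumes "f differentiable (at (a + c *\<^sub>R y))"
  shows "((\<lambda>y. k * f (a + c *\<^sub>R y)) has_derivative
    (\<lambda>h. k * frechet_derivative f (at (a + c *\<^sub>R y)) (c *\<^sub>R h))) (at y)"
proof -
  have "(f has_derivative frechet_derivative f (at (a + c *\<^sub>R y))) (at (a + c *\<^sub>R y))"
    using assms frechet_derivative_works by blast
  moreover have "((\<lambda>y. a + c *\<^sub>R y) has_derivative (\<lambda>h. c *\<^sub>R h)) (at y)"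
    by (auto intro!: derivative_eq_intros)
  ultimately have "((\<lambda>y. f (a + c *\<^sub>R y)) has_derivative
      (\<lambda>h. frechet_derivative f (at (a + c *\<^sub>R y)) (c *\<^sub>R h))) (at y)"
    using has_derivative_compose[of "\<lambda>y. a + c *\<^sub>R y" "\<lambda>h. c *\<^sub>R h" y UNIV f] by simp
  then show ?thesis by (rule has_derivative_mult_right)
qed

lemma iter_partial_affine:
  fixes f :: "real^'n \<Rightarrow> complex"
  assumes f: "smooth f"
  shows "iter_partial is (\<lambda>y. k * f (a + c *\<^sub>R y)) =
    (\<lambda>y. (k * of_real c ^ length is) * iter_partial is f (a + c *\<^sub>R y))"
proof (induction "is")
  case (Cons i "is")
  let ?g = "iter_partial is f"
  have d: "?g differentiable (at x)" for x using f by (simp add: smooth_def)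
  have lin: "linear (frechet_derivative ?g (at x))" for x
    using d by (rule linear_frechet_derivative)
  show ?case
    unfolding iter_partial.simps Cons.IH
    by (rule ext, subst partial_deriv_eqI[OF has_derivative_affine[OF d]])
      (simp add: linear_cmul[OF lin] partial_deriv_def scaleR_conv_of_real[where 'a=complex] mult_ac)
qed simp

lemma schwartz_affine:
  fixes f :: "real^'n \<Rightarrow> complex"
  assumes f: "f \<in> schwartz" and c: "c \<noteq> 0"
  shows "(\<lambda>y. k * f (a + c *\<^sub>R y)) \<in> schwartz"
proof -
  have sm: "smooth f" using f by (simp add: schwartz_def)
  have "smooth (\<lambda>y. k * f (a + c *\<^sub>R y))"
  proof (unfold smooth_def iter_partial_affine[OF sm], intro allI)
    fix "is" and x :: "real^'n"
    have d: "iter_partial is f differentiable (at (a + c *\<^sub>R x))"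
      using sm by (simp add: smooth_def)
    show "(\<lambda>y. (k * of_real c ^ length is) * iter_partial is f (a + c *\<^sub>R y)) differentiable (at x)"
      by (rule differentiableI, rule has_derivative_affine[OF d])
  qed
  moreover have "bdd_above (range (\<lambda>x. (1 + norm x) ^ N * norm (iter_partial is (\<lambda>y. k * f (a + c *\<^sub>R y)) x)))"
    for N "is"
  proof -
    obtain C where C: "0 \<le> C" "\<And>x. (1 + norm x) ^ N * norm (iter_partial is f x) \<le> C"
      using schwartz_bound[OF schwartz_iter_partial[OF f]] by blast
    \<comment> \<open>Chosen from \<open>norm x \<le> (norm (a + c *\<^sub>R x) + norm a) /
      \<bar>c\<bar>\<close>; it transfers the polynomial weight from \<open>x\<close> to its
      image.\<close>
    define K where "K = 1 + norm a / \<bar>c\<bar> + 1 / \<bar>c\<bar>"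
    have K: "1 + norm x \<le> K * (1 + norm (a + c *\<^sub>R x))" for x
    proof -
      have "\<bar>c\<bar> * norm x = norm ((a + c *\<^sub>R x) - a)" by simp
      also have "\<dots> \<le> norm (a + c *\<^sub>R x) + norm a" by (rule norm_triangle_ineq4)
      finally have "norm x \<le> norm (a + c *\<^sub>R x) / \<bar>c\<bar> + norm a / \<bar>c\<bar>"
        using c by (simp add: field_simps)
      moreover have "K * (1 + norm (a + c *\<^sub>R x)) = 1 + norm a / \<bar>c\<bar> + 1 / \<bar>c\<bar> + norm (a + c *\<^sub>R x)
          + norm a / \<bar>c\<bar> * norm (a + c *\<^sub>R x) + norm (a + c *\<^sub>R x) / \<bar>c\<bar>"
        by (simp add: K_def algebra_simps)
      moreover have "0 \<le> norm a / \<bar>c\<bar> * norm (a + c *\<^sub>R x)" "0 \<le> 1 / \<bar>c\<bar>" "0 \<le> norm (a + c *\<^sub>R x)"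
        by simp_all
      ultimately show ?thesis by linarith
    qed
    have K0: "0 \<le> K" by (simp add: K_def)
    show ?thesis
    proof (rule bdd_aboveI2)
      fix x
      have "(1 + norm x) ^ N \<le> K ^ N * (1 + norm (a + c *\<^sub>R x)) ^ N"
        unfolding power_mult_distrib[symmetric] using K by (rule power_mono) simp
      then have "(1 + norm x) ^ N * norm (iter_partial is f (a + c *\<^sub>R x)) \<le>
          K ^ N * ((1 + norm (a + c *\<^sub>R x)) ^ N * norm (iter_partial is f (a + c *\<^sub>R x)))"
        by (simp add: mult_right_mono mult.assoc[symmetric])
      also have "\<dots> \<le> K ^ N * C"
        using C K0 by (intro mult_left_mono) auto
      finally have "norm (k * of_real c ^ length is) * ((1 + norm x) ^ N * norm (iter_partial is f (a + c *\<^sub>R x)))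
          \<le> norm (k * of_real c ^ length is) * (K ^ N * C)"
        by (rule mult_left_mono) simp
      then show "(1 + norm x) ^ N * norm (iter_partial is (\<lambda>y. k * f (a + c *\<^sub>R y)) x)
          \<le> norm (k * of_real c ^ length is) * (K ^ N * C)"
        unfolding iter_partial_affine[OF sm] by (simp add: norm_mult mult_ac)
    qed
  qed
  ultimately show ?thesis by (simp add: schwartz_def)
qed

lemma iter_partial_sum:
  fixes f :: "'i \<Rightarrow> real^'n \<Rightarrow> complex"
  assumes f: "\<And>v. v \<in> A \<Longrightarrow> smooth (f v)"
  shows "iter_partial is (\<lambda>y. \<Sum>v\<in>A. c v * f v y) = (\<lambda>y. \<Sum>v\<in>A. c v * iter_partial is (f v) y)"
proof (induction "is")
  case (Cons i "is")
  have d: "((\<lambda>y. \<Sum>v\<in>A. c v * iter_partial is (f v) y) has_derivative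
      (\<lambda>h. \<Sum>v\<in>A. c v * frechet_derivative (iter_partial is (f v)) (at x) h)) (at x)" for x
    using f by (intro has_derivative_sum has_derivative_mult_right)
      (auto simp: smooth_def frechet_derivative_works[symmetric])
  show ?case
    unfolding iter_partial.simps Cons.IH
    by (rule ext, subst partial_deriv_eqI[OF d]) (simp add: partial_deriv_def)
qed simp

lemma schwartz_sum:
  fixes f :: "'i \<Rightarrow> real^'n \<Rightarrow> complex"
  assumes f: "\<And>v. v \<in> A \<Longrightarrow> f v \<in> schwartz"
  shows "(\<lambda>y. \<Sum>v\<in>A. c v * f v y) \<in> schwartz"
proof -
  have sm: "\<And>v. v \<in> A \<Longrightarrow> smooth (f v)" using f by (simp add: schwartz_def)
  have eq: "iter_partial is (\<lambda>y. \<Sum>v\<in>A. c v * f v y) = (\<lambda>y. \<Sum>v\<in>A. c v * iter_partial is (f v) y)" for "is"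
    by (rule iter_partial_sum) (rule sm)
  have "smooth (\<lambda>y. \<Sum>v\<in>A. c v * f v y)"
  proof (unfold smooth_def, intro allI)
    fix "is" and x :: "real^'n"
    have d: "iter_partial is (f v) differentiable (at x)" if "v \<in> A" for v
      using sm[OF that] by (simp add: smooth_def)
    show "iter_partial is (\<lambda>y. \<Sum>v\<in>A. c v * f v y) differentiable (at x)"
      unfolding eq
      by (rule differentiableI, rule has_derivative_sum, rule has_derivative_mult_right)
        (rule frechet_derivative_works[THEN iffD1, OF d])
  qed
  moreover have "bdd_above (range (\<lambda>x. (1 + norm x) ^ N * norm (iter_partial is (\<lambda>y. \<Sum>v\<in>A. c v * f v y) x)))"
    for N "is"
  proof -
    have "\<exists>C. \<forall>x. (1 + norm x) ^ N * norm (iter_partial is (f v) x) \<le> C" if "v \<in> A" for v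
      using schwartz_bound[OF schwartz_iter_partial[OF f[OF that]]] by metis
    then obtain C where C: "\<And>v x. v \<in> A \<Longrightarrow> (1 + norm x) ^ N * norm (iter_partial is (f v) x) \<le> C v"
      by metis
    show ?thesis
    proof (rule bdd_aboveI2)
      fix x
      have "(1 + norm x) ^ N * norm (\<Sum>v\<in>A. c v * iter_partial is (f v) x)
          \<le> (1 + norm x) ^ N * (\<Sum>v\<in>A. norm (c v) * norm (iter_partial is (f v) x))"
        by (intro mult_left_mono order_trans[OF norm_sum]) (auto simp: norm_mult)
      also have "\<dots> = (\<Sum>v\<in>A. norm (c v) * ((1 + norm x) ^ N * norm (iter_partial is (f v) x)))"
        by (simp add: sum_distrib_left mult_ac)
      also have "\<dots> \<le> (\<Sum>v\<in>A. norm (c v) * C v)"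
        by (intro sum_mono mult_left_mono C) auto
      finally show "(1 + norm x) ^ N * norm (iter_partial is (\<lambda>y. \<Sum>v\<in>A. c v * f v y) x) \<le> (\<Sum>v\<in>A. norm (c v) * C v)"
        unfolding eq .
    qed
  qed
  ultimately show ?thesis by (simp add: schwartz_def)
qed

section \<open>Reproducing formula for band-limited functions\<close>

text \<open>Fubini and translation invariance, after splitting the phase according to
  \<open>y = s *\<^sub>R z + (y - s *\<^sub>R z)\<close>. The scale sits in the argument of
  \<open>u\<close>, so no Jacobian appears and \<open>s\<close> multiplies the frequency of
  \<Psi>.\<close>

lemma fourier_convolution:
  fixes u \<Psi> :: "real^'n \<Rightarrow> complex"
  assumes u: "integrable lborel u" and \<Psi>: "integrable lborel \<Psi>"
  shows "integrable lborel (\<lambda>y. LINT z|lborel. \<Psi> z * u (y - s *\<^sub>R z))"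
    and "fourier (\<lambda>y. LINT z|lborel. \<Psi> z * u (y - s *\<^sub>R z)) \<xi> = fourier \<Psi> (s *\<^sub>R \<xi>) * fourier u \<xi>"
proof -
  have [measurable]: "u \<in> borel_measurable borel" "\<Psi> \<in> borel_measurable borel"
    using u \<Psi> by auto
  have transl: "(LINT y|lborel. h (y - s *\<^sub>R z)) = (LINT y|lborel. h y)"
    if "h \<in> borel_measurable borel" for z and h :: "real^'n \<Rightarrow> 'b::{banach, second_countable_topology}"
    using integral_lborel_affine[OF that, of 1 "- s *\<^sub>R z"] by (simp add: algebra_simps)
  have int_u: "integrable lborel (\<lambda>y. u (y - s *\<^sub>R z))" for z
    using integrable_lborel_affine[OF u, of 1 "- s *\<^sub>R z"] by (simp add: algebra_simps)
  \<comment> \<open>A factor \<open>e\<close> of modulus one is carried along: \<open>e = 1\<close>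
    gives integrability of the convolution, and the phase gives what Fubini needs for its
    transform.\<close>
  have int: "integrable (lborel \<Otimes>\<^sub>M lborel) (\<lambda>(z, y). e z y * (\<Psi> z * u (y - s *\<^sub>R z)))"
    if [measurable]: "(\<lambda>(z, y). e z y) \<in> borel_measurable (lborel \<Otimes>\<^sub>M lborel)"
      and norm_e: "\<And>z y. norm (e z y) = 1" for e :: "real^'n \<Rightarrow> real^'n \<Rightarrow> complex"
  proof (rule lborel_pair.Fubini_integrable)
    have me[measurable]: "(\<lambda>w. e (fst w) (snd w)) \<in> borel_measurable (lborel \<Otimes>\<^sub>M lborel)"
      using that(1) by (simp add: case_prod_beta')
    show "(\<lambda>(z, y). e z y * (\<Psi> z * u (y - s *\<^sub>R z))) \<in> borel_measurable (lborel \<Otimes>\<^sub>M lborel)"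
      unfolding case_prod_beta' by measurable
    have "(LINT y|lborel. norm (u (y - s *\<^sub>R z))) = (LINT y|lborel. norm (u y))" for z
      by (rule transl) measurable
    then show "integrable lborel (\<lambda>z. LINT y|lborel. norm (case (z, y) of (z, y) \<Rightarrow> e z y * (\<Psi> z * u (y - s *\<^sub>R z))))"
      using \<Psi> by (simp add: norm_mult norm_e integrable_norm)
    show "AE z in lborel. integrable lborel (\<lambda>y. case (z, y) of (z, y) \<Rightarrow> e z y * (\<Psi> z * u (y - s *\<^sub>R z)))"
    proof (intro AE_I2, unfold prod.case)
      fix z
      have "(\<lambda>y. e z y) \<in> borel_measurable lborel"
        using measurable_compose[OF measurable_Pair1' me, of z] by simp
      then show "integrable lborel (\<lambda>y. e z y * (\<Psi> z * u (y - s *\<^sub>R z)))"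
        by (intro Bochner_Integration.integrable_bound[OF integrable_mult_right[OF int_u, of "\<Psi> z"]])
          (auto simp: norm_mult norm_e)
    qed
  qed
  have "integrable (lborel \<Otimes>\<^sub>M lborel) (\<lambda>(z, y). \<Psi> z * u (y - s *\<^sub>R z))"
    using int[of "\<lambda>_ _. 1"] by simp
  from lborel_pair.integrable_snd[OF this]
  show "integrable lborel (\<lambda>y. LINT z|lborel. \<Psi> z * u (y - s *\<^sub>R z))" .
  let ?e = "\<lambda>y::real^'n. exp (- (\<i> * of_real (y \<bullet> \<xi>)))"
  have "fourier (\<lambda>y. LINT z|lborel. \<Psi> z * u (y - s *\<^sub>R z)) \<xi> =
      (LINT y|lborel. LINT z|lborel. ?e y * (\<Psi> z * u (y - s *\<^sub>R z)))"
    by (simp add: fourier_def)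
  also have "\<dots> = (LINT z|lborel. LINT y|lborel. ?e y * (\<Psi> z * u (y - s *\<^sub>R z)))"
    by (rule lborel_pair.Fubini_integral, rule int) (auto simp: case_prod_beta')
  also have "\<dots> = (LINT z|lborel. exp (- (\<i> * of_real (z \<bullet> (s *\<^sub>R \<xi>)))) * \<Psi> z * fourier u \<xi>)"
  proof (rule Bochner_Integration.integral_cong[OF refl])
    fix z
    have *: "?e y * (\<Psi> z * u (y - s *\<^sub>R z)) =
        exp (- (\<i> * of_real (z \<bullet> (s *\<^sub>R \<xi>)))) * \<Psi> z * (?e (y - s *\<^sub>R z) * u (y - s *\<^sub>R z))" for y
    proof -
      have "?e y = exp (- (\<i> * of_real (z \<bullet> (s *\<^sub>R \<xi>)))) * ?e (y - s *\<^sub>R z)"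
        unfolding exp_add[symmetric] by (simp add: inner_diff_left algebra_simps)
      then show ?thesis by (simp only: mult_ac)
    qed
    show "(LINT y|lborel. ?e y * (\<Psi> z * u (y - s *\<^sub>R z))) =
        exp (- (\<i> * of_real (z \<bullet> (s *\<^sub>R \<xi>)))) * \<Psi> z * fourier u \<xi>"
      unfolding * integral_mult_right_zero fourier_def
      by (subst transl[of "\<lambda>y. ?e y * u y"]) auto
  qed
  also have "\<dots> = fourier \<Psi> (s *\<^sub>R \<xi>) * fourier u \<xi>"
    unfolding fourier_def by (rule integral_mult_left_zero)
  finally show "fourier (\<lambda>y. LINT z|lborel. \<Psi> z * u (y - s *\<^sub>R z)) \<xi> = fourier \<Psi> (s *\<^sub>R \<xi>) * fourier u \<xi>" .
qed

lemma fourier_eq_0_outside_supp: "\<xi> \<notin> supp (fourier u) \<Longrightarrow> fourier u \<xi> = 0"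
  using closure_subset[of "{\<xi>. fourier u \<xi> \<noteq> 0}"] by (auto simp: supp_def)

text \<open>For \<open>t \<le> 1\<close> the point \<open>t *\<^sub>R \<xi>\<close> stays in the
  ball of radius \<open>1 / 2\<close>, which misses the support of \<open>fourier \<phi>\<close>, so
  the integral contributes nothing.\<close>

lemma resolution_of_unity_eq_1:
  fixes \<Phi> \<phi> :: "real^'n \<Rightarrow> complex"
  assumes R: "resolution_of_unity \<Phi> \<phi>" and \<xi>: "norm \<xi> \<le> 1 / 2"
  shows "fourier \<Phi> \<xi> = 1"
proof -
  have "fourier \<phi> (t *\<^sub>R \<xi>) = 0" if "t \<in> {0<..1}" for t
  proof (rule fourier_eq_0_outside_supp)
    have "norm (t *\<^sub>R \<xi>) \<le> 1 * (1 / 2)"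
      using that \<xi> by (simp only: norm_scaleR) (intro mult_mono, auto)
    then show "t *\<^sub>R \<xi> \<notin> supp (fourier \<phi>)"
      using R unfolding resolution_of_unity_def by force
  qed
  then have "(LINT t:{0<..1}|lborel. (1 / t) *\<^sub>R fourier \<phi> (t *\<^sub>R \<xi>)) =
      (LINT t:{0<..1::real}|lborel. 0)"
    by (intro set_lebesgue_integral_cong) auto
  moreover have "fourier \<Phi> \<xi> + (LINT t:{0<..1}|lborel. (1 / t) *\<^sub>R fourier \<phi> (t *\<^sub>R \<xi>)) = 1"
    using R unfolding resolution_of_unity_def by blast
  ultimately show ?thesis by (simp add: set_lebesgue_integral_def)
qed

text \<open>The factor \<open>1 / 4\<close> maps the ball of radius 2 into the ball of radius
  \<open>1 / 2\<close>, where \<open>fourier \<Phi>\<close> is 1, so both sides have the same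
  transform. Both are integrable, continuous and bounded, and injectivity gives equality at every
  point.\<close>

lemma band_limited_reproducing:
  fixes u \<Phi> \<phi> :: "real^'n \<Rightarrow> complex"
  assumes R: "resolution_of_unity \<Phi> \<phi>" and u: "u \<in> schwartz"
    and supp: "supp (fourier u) \<subseteq> {\<xi>. norm \<xi> < 2}"
  shows "u y = (LINT z|lborel. \<Phi> z * u (y - (1 / 4) *\<^sub>R z))"
proof -
  have \<Phi>: "\<Phi> \<in> schwartz" using R by (simp add: resolution_of_unity_def)
  note [measurable] = schwartz_measurable[OF \<Phi>] schwartz_measurable[OF u]
  have int_u: "integrable lborel u" and int_\<Phi>: "integrable lborel \<Phi>"
    using schwartz_integrable u \<Phi> by blast+
  let ?U = "\<lambda>y. LINT z|lborel. \<Phi> z * u (y - (1 / 4) *\<^sub>R z)"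
  note U = fourier_convolution[OF int_u int_\<Phi>, of "1 / 4"]
  obtain C where C: "0 \<le> C" "\<And>x. norm (u x) \<le> C" using schwartz_bounded[OF u] by blast
  have normU: "norm (?U y) \<le> (LINT z|lborel. norm (\<Phi> z) * C)" for y
  proof -
    have "norm (?U y) \<le> (LINT z|lborel. norm (\<Phi> z * u (y - (1 / 4) *\<^sub>R z)))"
      by (rule integral_norm_bound)
    also have "\<dots> \<le> (LINT z|lborel. norm (\<Phi> z) * C)"
      using C int_\<Phi> by (intro integral_mono') (auto simp: norm_mult mult_left_mono)
    finally show ?thesis .
  qed
  have contU: "isCont ?U y"
    unfolding continuous_at_sequentially comp_def
  proof (intro allI impI)
    fix Y :: "nat \<Rightarrow> real^'n" assume Y: "Y \<longlonglongrightarrow> y"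
    show "(\<lambda>k. ?U (Y k)) \<longlonglongrightarrow> ?U y"
    proof (rule integral_dominated_convergence[where w="\<lambda>z. norm (\<Phi> z) * C"])
      show "AE z in lborel. (\<lambda>k. \<Phi> z * u (Y k - (1 / 4) *\<^sub>R z)) \<longlonglongrightarrow> \<Phi> z * u (y - (1 / 4) *\<^sub>R z)"
        by (intro AE_I2 tendsto_intros isCont_tendsto_compose[OF schwartz_isCont[OF u]] Y)
      show "AE z in lborel. norm (\<Phi> z * u (Y k - (1 / 4) *\<^sub>R z)) \<le> norm (\<Phi> z) * C" for k
        by (intro AE_I2) (simp add: norm_mult C mult_left_mono)
      show "integrable lborel (\<lambda>z. norm (\<Phi> z) * C)" using int_\<Phi> by simp
    qed measurable
  qed
  have "?U y - u y = 0"
  proof (rule fourier_eq_0_imp_eq_0)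
    show "integrable lborel (\<lambda>y. ?U y - u y)" using U(1) int_u by simp
    show "isCont (\<lambda>y. ?U y - u y) y" using contU schwartz_isCont[OF u] by (rule isCont_diff)
    show "norm (?U y - u y) \<le> (LINT z|lborel. norm (\<Phi> z) * C) + C" for y
      by (rule order_trans[OF norm_triangle_ineq4 add_mono[OF normU C(2)]])
    show "fourier (\<lambda>y. ?U y - u y) \<xi> = 0" for \<xi>
    proof -
      have e: "integrable lborel (\<lambda>x. exp (- (\<i> * of_real (x \<bullet> \<xi>))) * h x)"
        if h: "integrable lborel h" for h :: "real^'n \<Rightarrow> complex"
      proof -
        have [measurable]: "h \<in> borel_measurable borel" using h by auto
        show ?thesis
          by (rule Bochner_Integration.integrable_bound[OF h]) (auto simp: norm_mult)
      qed
      have "fourier (\<lambda>y. ?U y - u y) \<xi> = fourier ?U \<xi> - fourier u \<xi>"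
        unfolding fourier_def right_diff_distrib
        by (rule Bochner_Integration.integral_diff[OF e[OF U(1)] e[OF int_u]])
      also have "\<dots> = (fourier \<Phi> ((1 / 4) *\<^sub>R \<xi>) - 1) * fourier u \<xi>"
        unfolding U(2) by (simp add: algebra_simps)
      also have "\<dots> = 0"
      \<comment> \<open>The first factor vanishes inside the band, the second outside it.\<close>
      proof (cases "norm \<xi> < 2")
        case True
        then show ?thesis using resolution_of_unity_eq_1[OF R, of "(1 / 4) *\<^sub>R \<xi>"] by simp
      next
        case False
        then show ?thesis using fourier_eq_0_outside_supp[of \<xi> u] supp by auto
      qed
      finally show ?thesis .
    qed
  qed
  then show ?thesis by simp
qed

text \<open>Mean value inequality along the segment from \<open>a - y\<close> to
  \<open>b - y\<close>; decay of the derivatives there becomes decay in \<open>y\<close> at the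
  price of a power of \<open>1 + norm a + norm b\<close>. Applied to every iterated derivative, it
  makes reflected translates locally Lipschitz in each Schwartz seminorm.\<close>

lemma schwartz_translation_lipschitz:
  fixes f :: "real^'n \<Rightarrow> complex"
  assumes f: "f \<in> schwartz"
  obtains C where "0 \<le> C" "\<And>a b y. (1 + norm y) ^ N * norm (f (a - y) - f (b - y))
    \<le> C * norm (a - b) * (1 + norm a + norm b) ^ N"
proof -
  have "\<exists>C. 0 \<le> C \<and> (\<forall>x. (1 + norm x) ^ N * norm (partial_deriv i f x) \<le> C)" for i
    using schwartz_bound[OF schwartz_partial_deriv[OF f]] by metis
  then obtain C where C: "\<And>i. 0 \<le> C i" "\<And>i x. (1 + norm x) ^ N * norm (partial_deriv i f x) \<le> C i"
    by metis
  have "(1 + norm y) ^ N * norm (f (a - y) - f (b - y))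
    \<le> (\<Sum>i\<in>UNIV. C i) * norm (a - b) * (1 + norm a + norm b) ^ N" for a b y
  proof -
    \<comment> \<open>The target bound without the factor \<open>norm (a - b)\<close> and with the
      weight in \<open>y\<close> divided out: a bound for the derivative on the whole
      segment.\<close>
    define B where "B = (\<Sum>i\<in>UNIV. C i) * (1 + norm a + norm b) ^ N / (1 + norm y) ^ N"
    have pos: "0 < (1 + norm x) ^ N" for x :: "real^'n" by (simp add: add_pos_nonneg)
    have "norm (f (a - y) - f (b - y)) \<le> B * norm ((a - y) - (b - y))"
    proof (rule differentiable_bound)
      show "convex (closed_segment (a - y) (b - y))" by simp
      show "a - y \<in> closed_segment (a - y) (b - y)" "b - y \<in> closed_segment (a - y) (b - y)" by simp_all
      fix x assume "x \<in> closed_segment (a - y) (b - y)"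
      then obtain v where v: "0 \<le> v" "v \<le> 1" "x = (1 - v) *\<^sub>R (a - y) + v *\<^sub>R (b - y)"
        by (auto simp: closed_segment_def)
      show "(f has_derivative frechet_derivative f (at x)) (at x within closed_segment (a - y) (b - y))"
        by (rule has_derivative_at_withinI[OF schwartz_has_derivative[OF f]])
      have "x + y = (1 - v) *\<^sub>R a + v *\<^sub>R b"
        by (simp add: v algebra_simps)
      then have "norm (x + y) \<le> (1 - v) * norm a + v * norm b"
        using norm_triangle_ineq[of "(1 - v) *\<^sub>R a" "v *\<^sub>R b"] v by simp
      also have "\<dots> \<le> 1 * norm a + 1 * norm b"
        using v by (intro add_mono mult_right_mono) auto
      finally have xy: "norm (x + y) \<le> norm a + norm b" by simp
      \<comment> \<open>Here \<open>x + y\<close> lies on the segment from \<open>a\<close> to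
        \<open>b\<close>, and \<open>norm y \<le> norm (x + y) + norm x\<close>.\<close>
      have "1 + norm y \<le> (1 + norm x) * (1 + norm a + norm b)"
      proof -
        have "norm y \<le> norm (x + y) + norm x"
          using norm_triangle_ineq4[of "x + y" x] by simp
        moreover have "(1 + norm x) * (1 + norm a + norm b) =
            1 + norm x + norm a + norm b + norm x * norm a + norm x * norm b"
          by (simp add: algebra_simps)
        moreover have "0 \<le> norm x * norm a" "0 \<le> norm x * norm b" by simp_all
        ultimately show ?thesis using xy by linarith
      qed
      then have "(1 + norm y) ^ N \<le> (1 + norm x) ^ N * (1 + norm a + norm b) ^ N"
        unfolding power_mult_distrib[symmetric] by (rule power_mono) simp
      then have le: "1 / (1 + norm x) ^ N \<le> (1 + norm a + norm b) ^ N / (1 + norm y) ^ N"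
        using pos[of x] pos[of y] by (simp add: field_simps)
      show "onorm (frechet_derivative f (at x)) \<le> B"
      proof (rule onorm_le)
        fix h
        have "norm (frechet_derivative f (at x) h) \<le> (\<Sum>i\<in>UNIV. norm (h $ i *\<^sub>R partial_deriv i f x))"
          unfolding frechet_derivative_partial[OF schwartz_differentiable[OF f]] by (rule norm_sum)
        also have "\<dots> \<le> (\<Sum>i\<in>UNIV. norm h * (C i * ((1 + norm a + norm b) ^ N / (1 + norm y) ^ N)))"
        proof (rule sum_mono)
          fix i
          have "norm (partial_deriv i f x) \<le> C i * (1 / (1 + norm x) ^ N)"
            using C(2)[of x i] pos[of x] by (simp add: field_simps)
          also have "\<dots> \<le> C i * ((1 + norm a + norm b) ^ N / (1 + norm y) ^ N)"
            using le C(1) by (rule mult_left_mono)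
          finally have "norm (partial_deriv i f x) \<le> C i * ((1 + norm a + norm b) ^ N / (1 + norm y) ^ N)" .
          then show "norm (h $ i *\<^sub>R partial_deriv i f x)
              \<le> norm h * (C i * ((1 + norm a + norm b) ^ N / (1 + norm y) ^ N))"
            unfolding norm_scaleR by (intro mult_mono) (auto simp: component_le_norm_cart)
        qed
        also have "\<dots> = B * norm h"
          by (simp add: B_def sum_distrib_left sum_distrib_right sum_divide_distrib mult_ac)
        finally show "norm (frechet_derivative f (at x) h) \<le> B * norm h" .
      qed
    qed
    then have "(1 + norm y) ^ N * norm (f (a - y) - f (b - y)) \<le> (1 + norm y) ^ N * (B * norm (a - b))"
      by (intro mult_left_mono) auto
    also have "\<dots> = (\<Sum>i\<in>UNIV. C i) * norm (a - b) * (1 + norm a + norm b) ^ N"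
      using pos[of y, THEN less_imp_neq] by (simp add: B_def)
    finally show ?thesis .
  qed
  moreover have "0 \<le> (\<Sum>i\<in>UNIV. C i)" by (intro sum_nonneg C(1))
  ultimately show ?thesis using that by blast
qed

section \<open>Differentiating the reproducing formula\<close>

lemma partial_deriv_difference_quotient:
  assumes f: "f \<in> schwartz"
  shows "(\<lambda>k. (f (x + inverse (real (Suc k)) *\<^sub>R axis i 1) - f x) /\<^sub>R inverse (real (Suc k)))
    \<longlonglongrightarrow> partial_deriv i f x"
proof -
  let ?D = "frechet_derivative f (at x)"
  let ?h = "\<lambda>k. inverse (real (Suc k)) *\<^sub>R axis i (1::real)"
  have D: "(f has_derivative ?D) (at x)" using f by (rule schwartz_has_derivative)
  then have lin: "linear ?D" by (rule has_derivative_linear)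
  have "(\<lambda>h. norm (f (x + h) - f x - ?D h) / norm h) \<midarrow>0\<rightarrow> 0"
    using D by (simp add: has_derivative_at)
  moreover have "filterlim ?h (at 0) sequentially"
  proof (rule filterlim_atI)
    have "?h \<longlonglongrightarrow> 0 *\<^sub>R axis i 1"
      by (intro tendsto_intros LIMSEQ_inverse_real_of_nat)
    then show "?h \<longlonglongrightarrow> 0" by simp
  qed (auto simp: axis_eq_0_iff)
  ultimately have "(\<lambda>k. norm (f (x + ?h k) - f x - ?D (?h k)) / norm (?h k)) \<longlonglongrightarrow> 0"
    by (rule filterlim_compose)
  moreover have "norm (f (x + ?h k) - f x - ?D (?h k)) / norm (?h k) =
      norm ((f (x + ?h k) - f x) /\<^sub>R inverse (real (Suc k)) - partial_deriv i f x)" for k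
  proof -
    have "(f (x + ?h k) - f x) /\<^sub>R inverse (real (Suc k)) - partial_deriv i f x =
        (f (x + ?h k) - f x - ?D (?h k)) /\<^sub>R inverse (real (Suc k))"
      by (simp add: linear_cmul[OF lin] partial_deriv_def scaleR_diff_right del: of_nat_Suc)
    then show ?thesis
      unfolding norm_scaleR by (simp add: norm_axis_1 divide_inverse mult.commute del: of_nat_Suc)
  qed
  ultimately have "(\<lambda>k. norm ((f (x + ?h k) - f x) /\<^sub>R inverse (real (Suc k)) - partial_deriv i f x)) \<longlonglongrightarrow> 0"
    by simp
  then show ?thesis by (simp only: tendsto_norm_zero_iff LIM_zero_iff)
qed

text \<open>The formula is linear and translation invariant, so difference quotients inherit it.
  They are bounded by a global Lipschitz constant of \<open>f\<close>, and dominated convergence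
  along the increments \<open>1 / (k + 1)\<close> gives the derivative.\<close>

lemma reproducing_partial_deriv:
  fixes f \<Psi> :: "real^'n \<Rightarrow> complex"
  assumes f: "f \<in> schwartz" and \<Psi>: "\<Psi> \<in> schwartz"
    and rep: "\<And>y. f y = (LINT z|lborel. \<Psi> z * f (y - s *\<^sub>R z))"
  shows "partial_deriv i f y = (LINT z|lborel. \<Psi> z * partial_deriv i f (y - s *\<^sub>R z))"
proof (rule LIMSEQ_unique[OF partial_deriv_difference_quotient[OF f]])
  note [measurable] = schwartz_measurable[OF f] schwartz_measurable[OF \<Psi>]
    schwartz_measurable[OF schwartz_partial_deriv[OF f]]
  let ?h = "\<lambda>k. inverse (real (Suc k)) *\<^sub>R axis i (1::real)"
  let ?q = "\<lambda>k x. (f (x + ?h k) - f x) /\<^sub>R inverse (real (Suc k))"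
  obtain B where B: "0 \<le> B" "\<And>x. norm (f x) \<le> B" using schwartz_bounded[OF f] by blast
  have int: "integrable lborel (\<lambda>z. \<Psi> z * f (x - s *\<^sub>R z))" for x
    by (rule Bochner_Integration.integrable_bound[OF integrable_mult_left[OF schwartz_integrable[OF \<Psi>], of "of_real B"]])
      (use B in \<open>auto simp: norm_mult intro!: mult_left_mono\<close>)
  \<comment> \<open>Exponent 0 and \<open>y = 0\<close> leave a plain Lipschitz estimate.\<close>
  obtain C where C: "0 \<le> C" "\<And>a b. norm (f a - f b) \<le> C * norm (a - b)"
    using schwartz_translation_lipschitz[OF f, of 0] by (metis diff_zero mult.left_neutral mult.right_neutral power_0)
  have q_le: "norm (?q k x) \<le> C" for k x
  proof -
    have "norm (f (x + ?h k) - f x) \<le> C * inverse (real (Suc k))"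
      using C(2)[of "x + ?h k" x] by (simp add: norm_axis_1)
    then have "real (Suc k) * norm (f (x + ?h k) - f x) \<le> real (Suc k) * (C * inverse (real (Suc k)))"
      by (rule mult_left_mono) simp
    moreover have "real (Suc k) * (C * inverse (real (Suc k))) = C" by simp
    ultimately show ?thesis by (simp del: of_nat_Suc)
  qed
  have "(\<lambda>k. LINT z|lborel. \<Psi> z * ?q k (y - s *\<^sub>R z)) \<longlonglongrightarrow>
      (LINT z|lborel. \<Psi> z * partial_deriv i f (y - s *\<^sub>R z))"
  proof (rule integral_dominated_convergence[where w="\<lambda>z. norm (\<Psi> z) * C"])
    show "AE z in lborel. (\<lambda>k. \<Psi> z * ?q k (y - s *\<^sub>R z)) \<longlonglongrightarrow> \<Psi> z * partial_deriv i f (y - s *\<^sub>R z)"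
      by (intro AE_I2 tendsto_mult tendsto_const partial_deriv_difference_quotient[OF f])
    show "AE z in lborel. norm (\<Psi> z * ?q k (y - s *\<^sub>R z)) \<le> norm (\<Psi> z) * C" for k
      using q_le by (intro AE_I2) (simp only: norm_mult mult_left_mono norm_ge_zero)
    show "integrable lborel (\<lambda>z. norm (\<Psi> z) * C)" using schwartz_integrable[OF \<Psi>] by simp
  qed measurable
  moreover have "(LINT z|lborel. \<Psi> z * ?q k (y - s *\<^sub>R z)) = ?q k y" for k
  proof -
    have "?q k y = ((LINT z|lborel. \<Psi> z * f (y + ?h k - s *\<^sub>R z)) - (LINT z|lborel. \<Psi> z * f (y - s *\<^sub>R z))) /\<^sub>R inverse (real (Suc k))"
      using rep[of "y + ?h k"] rep[of y] by simp
    also have "\<dots> = (LINT z|lborel. (\<Psi> z * f (y + ?h k - s *\<^sub>R z) - \<Psi> z * f (y - s *\<^sub>R z)) /\<^sub>R inverse (real (Suc k)))"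
      by (subst integral_scaleR_right, subst Bochner_Integration.integral_diff[OF int int]) (rule refl)
    also have "\<dots> = (LINT z|lborel. \<Psi> z * ?q k (y - s *\<^sub>R z))"
      by (simp add: algebra_simps)
    finally show ?thesis by simp
  qed
  ultimately show "(\<lambda>k. ?q k y) \<longlonglongrightarrow> (LINT z|lborel. \<Psi> z * partial_deriv i f (y - s *\<^sub>R z))"
    by simp
qed

text \<open>The seminorms that control a tempered distribution contain derivatives of several
  orders, so each of them needs the formula.\<close>

lemma reproducing_iter_partial:
  fixes f \<Psi> :: "real^'n \<Rightarrow> complex"
  assumes f: "f \<in> schwartz" and \<Psi>: "\<Psi> \<in> schwartz"
    and rep: "\<And>y. f y = (LINT z|lborel. \<Psi> z * f (y - s *\<^sub>R z))"
  shows "iter_partial is f y = (LINT z|lborel. \<Psi> z * iter_partial is f (y - s *\<^sub>R z))"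
  by (induction "is" arbitrary: y)
    (auto intro: rep reproducing_partial_deriv[OF schwartz_iter_partial[OF f] \<Psi>])

section \<open>Convolution with tempered distributions\<close>

lemma schwartz_reflect:
  fixes u :: "real^'n \<Rightarrow> complex"
  assumes "u \<in> schwartz"
  shows "(\<lambda>y. u (x - y)) \<in> schwartz"
  using schwartz_affine[OF assms, of "-1" 1 x] by simp

lemma iter_partial_reflect:
  fixes u :: "real^'n \<Rightarrow> complex"
  assumes "u \<in> schwartz"
  shows "iter_partial is (\<lambda>y. u (x - y)) = (\<lambda>y. (-1) ^ length is * iter_partial is u (x - y))"
  using iter_partial_affine[of u "is" 1 x "-1"] assms by (simp add: schwartz_def)

text \<open>A difference is treated as a sum over the two booleans with coefficients 1 and -1, so
  that the results on finite sums apply.\<close>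

lemma schwartz_diff:
  fixes f g :: "real^'n \<Rightarrow> complex"
  assumes "f \<in> schwartz" "g \<in> schwartz"
  shows "(\<lambda>y. f y - g y) \<in> schwartz"
  using schwartz_sum[of UNIV "\<lambda>b. if b then f else g" "\<lambda>b. if b then 1 else -1"] assms
  by (simp add: UNIV_bool)

lemma iter_partial_diff:
  fixes f g :: "real^'n \<Rightarrow> complex"
  assumes "f \<in> schwartz" "g \<in> schwartz"
  shows "iter_partial is (\<lambda>y. f y - g y) = (\<lambda>y. iter_partial is f y - iter_partial is g y)"
  using iter_partial_sum[of UNIV "\<lambda>b. if b then f else g" "is" "\<lambda>b. if b then 1 else -1"] assms
  by (simp add: UNIV_bool schwartz_def)

lemma tempered_add:
  "T \<in> tempered \<Longrightarrow> f \<in> schwartz \<Longrightarrow> g \<in> schwartz \<Longrightarrow> T (\<lambda>y. f y + g y) = T f + T g"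
  unfolding tempered_def by auto

lemma tempered_cmult: "T \<in> tempered \<Longrightarrow> f \<in> schwartz \<Longrightarrow> T (\<lambda>y. c * f y) = c * T f"
  unfolding tempered_def by auto

lemma tempered_sum:
  fixes T :: "(real^'n \<Rightarrow> complex) \<Rightarrow> complex"
  assumes T: "T \<in> tempered" and f: "\<And>v. v \<in> A \<Longrightarrow> f v \<in> schwartz" and "finite A"
  shows "T (\<lambda>y. \<Sum>v\<in>A. c v * f v y) = (\<Sum>v\<in>A. c v * T (f v))"
  using \<open>finite A\<close> f
proof (induction A rule: finite_induct)
  case empty
  have "(\<lambda>y::real^'n. 0 :: complex) \<in> schwartz" using schwartz_sum[of "{}"] by simp
  from tempered_cmult[OF T this, of 0] show ?case by simp
next
  case (insert v A)
  have v: "f v \<in> schwartz" and A: "(\<lambda>y. \<Sum>v\<in>A. c v * f v y) \<in> schwartz"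
    using insert.prems by (auto intro: schwartz_sum)
  then have cv: "(\<lambda>y. c v * f v y) \<in> schwartz"
    using schwartz_affine[OF v, of 1 "c v" 0] by simp
  have "T (\<lambda>y. c v * f v y + (\<Sum>v\<in>A. c v * f v y)) = T (\<lambda>y. c v * f v y) + T (\<lambda>y. \<Sum>v\<in>A. c v * f v y)"
    by (rule tempered_add[OF T cv A])
  moreover have "T (\<lambda>y. c v * f v y) = c v * T (f v)"
    by (rule tempered_cmult[OF T v])
  ultimately show ?case using insert by simp
qed

lemma tempered_diff:
  fixes T :: "(real^'n \<Rightarrow> complex) \<Rightarrow> complex"
  assumes T: "T \<in> tempered" and "f \<in> schwartz" "g \<in> schwartz"
  shows "T (\<lambda>y. f y - g y) = T f - T g"
  using tempered_sum[OF T, of UNIV "\<lambda>b. if b then f else g" "\<lambda>b. if b then 1 else -1"] assms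
  by (simp add: UNIV_bool)

text \<open>Pointwise bounds \<open>B\<close> replace the suprema in the seminorms, so later
  estimates can be made one point at a time; \<open>C\<close> and \<open>N\<close> depend only on
  \<open>T\<close>.\<close>

lemma tempered_bound:
  fixes T :: "(real^'n \<Rightarrow> complex) \<Rightarrow> complex"
  assumes T: "T \<in> tempered"
  obtains C N where "0 \<le> C" "\<And>f B. f \<in> schwartz \<Longrightarrow>
    (\<And>is x. length is \<le> N \<Longrightarrow> (1 + norm x) ^ N * norm (iter_partial is f x) \<le> B is) \<Longrightarrow>
    norm (T f) \<le> C * (\<Sum>is | length is \<le> N. B is)"
proof -
  obtain C N where CN: "\<And>f. f \<in> schwartz \<Longrightarrow> norm (T f) \<le> C * (\<Sum>is | length is \<le> N. schwartz_seminorm N is f)"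
    using T unfolding tempered_def by blast
  \<comment> \<open>The constant in \<open>tempered\<close> carries no sign condition, hence the
    absolute value.\<close>
  have "norm (T f) \<le> \<bar>C\<bar> * (\<Sum>is | length is \<le> N. B is)"
    if f: "f \<in> schwartz" and B: "\<And>is x. length is \<le> N \<Longrightarrow> (1 + norm x) ^ N * norm (iter_partial is f x) \<le> B is" for f B
  proof -
    have 1: "schwartz_seminorm N is f \<le> B is" if "length is \<le> N" for "is"
      unfolding schwartz_seminorm_def by (rule cSUP_least) (use B[OF that] in auto)
    have 2: "0 \<le> schwartz_seminorm N is f" for "is"
    proof -
      have "bdd_above (range (\<lambda>x. (1 + norm x) ^ N * norm (iter_partial is f x)))"
        using f by (simp add: schwartz_def)
      then show ?thesis
        unfolding schwartz_seminorm_def by (rule cSUP_upper2[of _ _ 0]) auto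
    qed
    have "norm (T f) \<le> C * (\<Sum>is | length is \<le> N. schwartz_seminorm N is f)" by (rule CN[OF f])
    also have "\<dots> \<le> \<bar>C\<bar> * (\<Sum>is | length is \<le> N. schwartz_seminorm N is f)"
      by (intro mult_right_mono sum_nonneg 2) simp
    also have "\<dots> \<le> \<bar>C\<bar> * (\<Sum>is | length is \<le> N. B is)"
      by (intro mult_left_mono sum_mono) (auto intro: 1)
    finally show ?thesis .
  qed
  then show ?thesis using that[of "\<bar>C\<bar>" N] by auto
qed

text \<open>By linearity the difference is \<open>T\<close> applied to a difference of two reflected
  translates of \<open>u\<close>, whose seminorms \<open>schwartz_translation_lipschitz\<close>
  controls. Continuity, measurability and polynomial growth of \<open>conv u T\<close> all come from
  this.\<close>

lemma conv_lipschitz: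
  fixes T :: "(real^'n \<Rightarrow> complex) \<Rightarrow> complex"
  assumes T: "T \<in> tempered" and u: "u \<in> schwartz"
  obtains C N where "0 \<le> C" "\<And>a b. norm (conv u T a - conv u T b) \<le> C * norm (a - b) * (1 + norm a + norm b) ^ N"
proof -
  obtain C N where CN: "0 \<le> C" "\<And>f B. f \<in> schwartz \<Longrightarrow>
    (\<And>is x. length is \<le> N \<Longrightarrow> (1 + norm x) ^ N * norm (iter_partial is f x) \<le> B is) \<Longrightarrow>
    norm (T f) \<le> C * (\<Sum>is | length is \<le> N. B is)"
    using tempered_bound[OF T] by blast
  have "\<exists>K. 0 \<le> K \<and> (\<forall>a b y. (1 + norm y) ^ N * norm (iter_partial is u (a - y) - iter_partial is u (b - y))
    \<le> K * norm (a - b) * (1 + norm a + norm b) ^ N)" for "is"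
    using schwartz_translation_lipschitz[OF schwartz_iter_partial[OF u]] by metis
  then obtain K where K: "\<And>is. 0 \<le> K is" "\<And>is a b y. (1 + norm y) ^ N * norm (iter_partial is u (a - y) - iter_partial is u (b - y))
    \<le> K is * norm (a - b) * (1 + norm a + norm b) ^ N"
    by metis
  have "norm (conv u T a - conv u T b) \<le> C * (\<Sum>is | length is \<le> N. K is) * norm (a - b) * (1 + norm a + norm b) ^ N" for a b
  proof -
    have "norm (conv u T a - conv u T b) = norm (T (\<lambda>y. u (a - y) - u (b - y)))"
      unfolding conv_def by (subst tempered_diff[OF T]) (auto intro: schwartz_reflect u)
    also have "\<dots> \<le> C * (\<Sum>is | length is \<le> N. K is * norm (a - b) * (1 + norm a + norm b) ^ N)"
    proof (rule CN(2))
      show "(\<lambda>y. u (a - y) - u (b - y)) \<in> schwartz"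
        by (intro schwartz_diff schwartz_reflect u)
      show "(1 + norm y) ^ N * norm (iter_partial is (\<lambda>y. u (a - y) - u (b - y)) y)
          \<le> K is * norm (a - b) * (1 + norm a + norm b) ^ N" for "is" y
        using K(2)[of y "is" a b]
        by (simp add: iter_partial_diff schwartz_reflect u iter_partial_reflect norm_mult norm_power
            flip: right_diff_distrib)
    qed
    finally show ?thesis by (simp add: sum_distrib_right mult.assoc)
  qed
  moreover have "0 \<le> C * (\<Sum>is | length is \<le> N. K is)"
    using CN(1) K(1) by (simp add: sum_nonneg)
  ultimately show ?thesis using that by blast
qed

lemma conv_growth:
  fixes T :: "(real^'n \<Rightarrow> complex) \<Rightarrow> complex"
  assumes T: "T \<in> tempered" and u: "u \<in> schwartz"
  obtains C N where "0 \<le> C" "\<And>a. norm (conv u T a) \<le> C * (1 + norm a) ^ N"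
proof -
  obtain C N where C: "0 \<le> C" "\<And>a b. norm (conv u T a - conv u T b) \<le> C * norm (a - b) * (1 + norm a + norm b) ^ N"
    using conv_lipschitz[OF T u] by blast
  \<comment> \<open>The Lipschitz estimate with \<open>b = 0\<close>; its factor
    \<open>norm a\<close> costs one more power, hence \<open>Suc N\<close>.\<close>
  have "norm (conv u T a) \<le> (norm (conv u T 0) + C) * (1 + norm a) ^ Suc N" for a
  proof -
    have one: "1 \<le> (1 + norm a) ^ M" for M by (rule one_le_power) simp
    have "norm (conv u T a) \<le> norm (conv u T 0) + norm (conv u T a - conv u T 0)"
      by (rule norm_triangle_sub)
    also have "\<dots> \<le> norm (conv u T 0) * (1 + norm a) ^ Suc N + C * (1 + norm a) ^ Suc N"
    proof (rule add_mono)
      show "norm (conv u T 0) \<le> norm (conv u T 0) * (1 + norm a) ^ Suc N"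
        using mult_left_mono[OF one[of "Suc N"], of "norm (conv u T 0)"] by simp
      have "C * norm a * (1 + norm a) ^ N \<le> C * (1 + norm a) * (1 + norm a) ^ N"
        using C(1) by (intro mult_right_mono mult_left_mono) auto
      then show "norm (conv u T a - conv u T 0) \<le> C * (1 + norm a) ^ Suc N"
        using C(2)[of a 0] by (simp add: mult.assoc)
    qed
    finally show ?thesis by (simp only: distrib_right)
  qed
  moreover have "0 \<le> norm (conv u T 0) + C" using C(1) by simp
  ultimately show ?thesis using that by blast
qed

lemma conv_isCont:
  fixes T :: "(real^'n \<Rightarrow> complex) \<Rightarrow> complex"
  assumes T: "T \<in> tempered" and u: "u \<in> schwartz"
  shows "isCont (conv u T) a"
proof -
  obtain C N where C: "0 \<le> C" "\<And>a b. norm (conv u T a - conv u T b) \<le> C * norm (a - b) * (1 + norm a + norm b) ^ N"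
    using conv_lipschitz[OF T u] by blast
  have "((\<lambda>b. conv u T b - conv u T a) \<longlongrightarrow> 0) (at a)"
  proof (rule Lim_null_comparison)
    show "\<forall>\<^sub>F b in at a. norm (conv u T b - conv u T a) \<le> C * norm (b - a) * (1 + norm b + norm a) ^ N"
      by (intro always_eventually allI C(2))
    have "((\<lambda>b. C * norm (b - a) * (1 + norm b + norm a) ^ N) \<longlongrightarrow> C * norm (a - a) * (1 + norm a + norm a) ^ N) (at a)"
      by (intro tendsto_intros)
    then show "((\<lambda>b. C * norm (b - a) * (1 + norm b + norm a) ^ N) \<longlongrightarrow> 0) (at a)" by simp
  qed
  then show ?thesis by (simp add: isCont_def LIM_zero_iff)
qed

lemma conv_measurable:
  fixes T :: "(real^'n \<Rightarrow> complex) \<Rightarrow> complex"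
  assumes T: "T \<in> tempered" and u: "u \<in> schwartz"
  shows "conv u T \<in> borel_measurable borel"
  by (intro borel_measurable_continuous_onI continuous_at_imp_continuous_on ballI conv_isCont T u)

text \<open>Group the integral by the finitely many values of \<open>S\<close>. The coefficients do
  not depend on \<open>h\<close>, so one combination serves translates of \<open>u\<close>, their
  derivatives, and values of \<open>conv u T\<close>.\<close>

lemma integral_simple_function_comp:
  fixes \<Psi> h :: "_ \<Rightarrow> complex"
  assumes S: "simple_function M S" and \<Psi>: "integrable M \<Psi>"
  shows "(LINT z|M. \<Psi> z * h (S z)) =
    (\<Sum>v\<in>S ` space M. (LINT z|M. indicator (S -` {v} \<inter> space M) z *\<^sub>R \<Psi> z) * h v)"
proof -
  have int: "integrable M (\<lambda>z. indicator (S -` {v} \<inter> space M) z *\<^sub>R \<Psi> z * h v)" for v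
    using simple_functionD(2)[OF S, of "{v}"] \<Psi> by (intro integrable_mult_left integrable_mult_indicator)
  have fin: "finite (S ` space M)" using S by (rule simple_functionD)
  have "(LINT z|M. \<Psi> z * h (S z)) = (LINT z|M. (\<Sum>v\<in>S ` space M. indicator (S -` {v} \<inter> space M) z *\<^sub>R \<Psi> z * h v))"
  proof (rule Bochner_Integration.integral_cong[OF refl])
    fix z assume z: "z \<in> space M"
    have "(\<Sum>v\<in>S ` space M. indicator (S -` {v} \<inter> space M) z *\<^sub>R \<Psi> z * h v) =
        (\<Sum>v\<in>S ` space M. if v = S z then \<Psi> z * h v else 0)"
      using z by (intro sum.cong) (auto simp: indicator_def)
    then show "\<Psi> z * h (S z) = (\<Sum>v\<in>S ` space M. indicator (S -` {v} \<inter> space M) z *\<^sub>R \<Psi> z * h v)"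
      using fin z by simp
  qed
  also have "\<dots> = (\<Sum>v\<in>S ` space M. LINT z|M. indicator (S -` {v} \<inter> space M) z *\<^sub>R \<Psi> z * h v)"
    by (rule Bochner_Integration.integral_sum) (rule int)
  finally show ?thesis by (simp only: integral_mult_left_zero)
qed

text \<open>A tempered distribution commutes with the integral because the integral is the limit, in
  every Schwartz seminorm, of the finite sums obtained by replacing the translation parameter by a
  simple function of it.\<close>

lemma conv_reproducing:
  fixes T :: "(real^'n \<Rightarrow> complex) \<Rightarrow> complex"
  assumes T: "T \<in> tempered" and u: "u \<in> schwartz" and \<Psi>: "\<Psi> \<in> schwartz"
    and rep: "\<And>y. u y = (LINT z|lborel. \<Psi> z * u (y - s *\<^sub>R z))"
  shows "conv u T x = (LINT z|lborel. \<Psi> z * conv u T (x - s *\<^sub>R z))"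
proof -
  note [measurable] = schwartz_measurable[OF u] schwartz_measurable[OF \<Psi>] conv_measurable[OF T u]
  have int_\<Psi>: "integrable lborel \<Psi>" using \<Psi> by (rule schwartz_integrable)
  \<comment> \<open>Simple approximations of the identity map; the bound \<open>2 * norm z\<close>
    makes majorants independent of \<open>i\<close> possible.\<close>
  have "(\<lambda>z::real^'n. z) \<in> borel_measurable lborel" by simp
  from borel_measurable_implies_sequence_metric[OF this, of 0] obtain S where
    S: "\<And>i. simple_function lborel (S i)" and S_lim: "\<And>z. (\<lambda>i. S i z) \<longlonglongrightarrow> z"
    and S_le: "\<And>i z. norm (S i z) \<le> 2 * norm (z::real^'n)"
    by auto
  have [measurable]: "S i \<in> borel_measurable borel" for i
    using borel_measurable_simple_function[OF S] by simp
  \<comment> \<open>A finite combination of reflected translates that approximates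
    \<open>\<lambda>y. u (x - y)\<close>, which by \<open>rep\<close> is the same integral with
    \<open>z\<close> in place of \<open>S i z\<close>.\<close>
  define g where "g i y = (LINT z|lborel. \<Psi> z * u (x - s *\<^sub>R S i z - y))" for i y
  define a where "a i v = (LINT z|lborel. indicator (S i -` {v} \<inter> space lborel) z *\<^sub>R \<Psi> z)" for i v
  have fin: "finite (range (S i))" for i using simple_functionD(1)[OF S, of i] by simp
  have sum_eq: "(LINT z|lborel. \<Psi> z * h (S i z)) = (\<Sum>v\<in>range (S i). a i v * h v)" for h i
    using integral_simple_function_comp[OF S int_\<Psi>, of h i] by (simp add: a_def)
  have g_eq: "g i = (\<lambda>y. \<Sum>v\<in>range (S i). a i v * u (x - s *\<^sub>R v - y))" for i
    unfolding g_def by (rule ext) (rule sum_eq)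
  have g_schwartz: "g i \<in> schwartz" for i
    unfolding g_eq by (intro schwartz_sum schwartz_reflect u)
  have Tg: "T (g i) = (LINT z|lborel. \<Psi> z * conv u T (x - s *\<^sub>R S i z))" for i
    unfolding g_eq sum_eq[of "\<lambda>v. conv u T (x - s *\<^sub>R v)"]
    unfolding conv_def by (intro tempered_sum[OF T _ fin] schwartz_reflect u)

  obtain C N where CN: "0 \<le> C" "\<And>f B. f \<in> schwartz \<Longrightarrow>
    (\<And>is x. length is \<le> N \<Longrightarrow> (1 + norm x) ^ N * norm (iter_partial is f x) \<le> B is) \<Longrightarrow>
    norm (T f) \<le> C * (\<Sum>is | length is \<le> N. B is)"
    using tempered_bound[OF T] by blast
  have "\<exists>K. 0 \<le> K \<and> (\<forall>a b y. (1 + norm y) ^ N * norm (iter_partial is u (a - y) - iter_partial is u (b - y))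
    \<le> K * norm (a - b) * (1 + norm a + norm b) ^ N)" for "is"
    using schwartz_translation_lipschitz[OF schwartz_iter_partial[OF u]] by metis
  then obtain K where K: "\<And>is. 0 \<le> K is" "\<And>is a b y. (1 + norm y) ^ N * norm (iter_partial is u (a - y) - iter_partial is u (b - y))
    \<le> K is * norm (a - b) * (1 + norm a + norm b) ^ N"
    by metis

  \<comment> \<open>Up to the factor \<open>K is\<close>, \<open>d i z\<close> bounds the weighted
    error of replacing \<open>z\<close> by \<open>S i z\<close>, and \<open>w\<close> is its
    integrable majorant for all \<open>i\<close>.\<close>
  define d where "d i z = norm (\<Psi> z) * (norm (s *\<^sub>R (z - S i z)) * (1 + norm (x - s *\<^sub>R S i z) + norm (x - s *\<^sub>R z)) ^ N)" for i z
  define w where "w z = (1 + 2 * norm x + 3 * \<bar>s\<bar>) ^ N * (3 * \<bar>s\<bar>) * ((1 + norm z) ^ Suc N * norm (\<Psi> z))" for z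
  have d_nonneg: "0 \<le> d i z" for i z by (simp add: d_def)
  have [measurable]: "d i \<in> borel_measurable borel" for i unfolding d_def[abs_def] by measurable
  have int_w: "integrable lborel w"
    unfolding w_def[abs_def] by (intro integrable_mult_right schwartz_weighted_integrable \<Psi>)
  have d_le: "d i z \<le> w z" for i z
  proof -
    have "norm (z - S i z) \<le> 3 * norm z"
      using norm_triangle_ineq4[of z "S i z"] S_le[of i z] by linarith
    then have 1: "norm (s *\<^sub>R (z - S i z)) \<le> 3 * \<bar>s\<bar> * (1 + norm z)"
      using mult_left_mono[of "norm (z - S i z)" "3 * (1 + norm z)" "\<bar>s\<bar>"] unfolding norm_scaleR by (simp add: distrib_left)
    have "norm (x - s *\<^sub>R S i z) \<le> norm x + \<bar>s\<bar> * (2 * norm z)"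
      using norm_triangle_ineq4[of x "s *\<^sub>R S i z"] mult_left_mono[OF S_le[of i z], of "\<bar>s\<bar>"] by simp
    moreover have "norm (x - s *\<^sub>R z) \<le> norm x + \<bar>s\<bar> * norm z"
      using norm_triangle_ineq4[of x "s *\<^sub>R z"] by simp
    moreover have "(1 + 2 * norm x + 3 * \<bar>s\<bar>) * (1 + norm z) =
        1 + 2 * norm x + 3 * \<bar>s\<bar> + norm z + 2 * norm x * norm z + 3 * (\<bar>s\<bar> * norm z)"
      by (simp add: algebra_simps)
    moreover have "0 \<le> norm x * norm z" "0 \<le> \<bar>s\<bar> * norm z" "0 \<le> norm z" "0 \<le> \<bar>s\<bar>" by simp_all
    ultimately have "1 + norm (x - s *\<^sub>R S i z) + norm (x - s *\<^sub>R z) \<le> (1 + 2 * norm x + 3 * \<bar>s\<bar>) * (1 + norm z)"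
      by linarith
    then have 2: "(1 + norm (x - s *\<^sub>R S i z) + norm (x - s *\<^sub>R z)) ^ N \<le> (1 + 2 * norm x + 3 * \<bar>s\<bar>) ^ N * (1 + norm z) ^ N"
      unfolding power_mult_distrib[symmetric] by (rule power_mono) simp
    have "d i z \<le> norm (\<Psi> z) * ((3 * \<bar>s\<bar> * (1 + norm z)) * ((1 + 2 * norm x + 3 * \<bar>s\<bar>) ^ N * (1 + norm z) ^ N))"
      unfolding d_def using 1 2 by (intro mult_left_mono mult_mono) auto
    then show ?thesis by (simp only: w_def power_Suc mult_ac)
  qed
  have int_d: "integrable lborel (d i)" for i
    by (rule Bochner_Integration.integrable_bound[OF int_w])
      (auto simp: abs_of_nonneg[OF d_nonneg] intro: order_trans[OF d_le abs_ge_self])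
  have d_lim: "(\<lambda>i. LINT z|lborel. d i z) \<longlonglongrightarrow> 0"
  proof -
    have "(\<lambda>i. LINT z|lborel. d i z) \<longlonglongrightarrow> (LINT z::real^'n|lborel. 0::real)"
    proof (rule integral_dominated_convergence[OF _ _ int_w])
      show "AE z in lborel. (\<lambda>i. d i z) \<longlonglongrightarrow> 0"
      proof (intro AE_I2)
        fix z
        have "(\<lambda>i. d i z) \<longlonglongrightarrow> norm (\<Psi> z) * (norm (s *\<^sub>R (z - z)) * (1 + norm (x - s *\<^sub>R z) + norm (x - s *\<^sub>R z)) ^ N)"
          unfolding d_def by (intro tendsto_intros S_lim)
        then show "(\<lambda>i. d i z) \<longlonglongrightarrow> 0" by simp
      qed
      show "AE z in lborel. norm (d i z) \<le> w z" for i
        using d_le d_nonneg by simp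
    qed measurable
    then show ?thesis by simp
  qed
  \<comment> \<open>By the reproducing formula each derivative of the error is an integral of \<Psi>
    against a difference of two translates. The sign from reflection is common to both and
    disappears in the norm.\<close>
  have T_le: "norm (T (g i) - conv u T x) \<le> C * (\<Sum>is | length is \<le> N. K is * (LINT z|lborel. d i z))" for i
  proof -
    have "norm (T (g i) - conv u T x) = norm (T (\<lambda>y. g i y - u (x - y)))"
      unfolding conv_def by (subst tempered_diff[OF T]) (auto intro: schwartz_reflect u g_schwartz)
    also have "\<dots> \<le> C * (\<Sum>is | length is \<le> N. K is * (LINT z|lborel. d i z))"
    proof (rule CN(2))
      show "(\<lambda>y. g i y - u (x - y)) \<in> schwartz"
        by (intro schwartz_diff schwartz_reflect u g_schwartz)
      fix "is" :: "'n list" and y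
      let ?v = "iter_partial is u"
      have v: "?v \<in> schwartz" using u by (rule schwartz_iter_partial)
      note [measurable] = schwartz_measurable[OF v]
      obtain B where B: "0 \<le> B" "\<And>x. norm (?v x) \<le> B" using schwartz_bounded[OF v] by blast
      have int: "integrable lborel (\<lambda>z. \<Psi> z * ?v (h z))" if [measurable]: "h \<in> borel_measurable borel" for h
        by (rule Bochner_Integration.integrable_bound[OF integrable_mult_left[OF int_\<Psi>, of "of_real B"]])
          (use B in \<open>auto simp: norm_mult intro!: mult_left_mono\<close>)
      have "iter_partial is (g i) y = (-1) ^ length is * (LINT z|lborel. \<Psi> z * ?v (x - s *\<^sub>R S i z - y))"
        unfolding g_eq sum_eq[of "\<lambda>v. ?v (x - s *\<^sub>R v - y)"]
        by (subst iter_partial_sum)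
          (auto simp: iter_partial_reflect[OF u] sum_distrib_left mult_ac schwartz_reflect[OF u] intro: schwartz_reflect[OF u, unfolded schwartz_def, simplified, THEN conjunct1])
      moreover have "iter_partial is (\<lambda>y. u (x - y)) y = (-1) ^ length is * (LINT z|lborel. \<Psi> z * ?v (x - s *\<^sub>R z - y))"
        unfolding iter_partial_reflect[OF u]
        using reproducing_iter_partial[OF u \<Psi> rep, of "is" "x - y"] by (simp add: algebra_simps)
      ultimately have "norm (iter_partial is (\<lambda>y. g i y - u (x - y)) y) =
          norm ((LINT z|lborel. \<Psi> z * ?v (x - s *\<^sub>R S i z - y)) - (LINT z|lborel. \<Psi> z * ?v (x - s *\<^sub>R z - y)))"
        by (simp add: iter_partial_diff[OF g_schwartz schwartz_reflect[OF u]] norm_mult norm_power flip: right_diff_distrib)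
      also have "\<dots> = norm (LINT z|lborel. \<Psi> z * (?v (x - s *\<^sub>R S i z - y) - ?v (x - s *\<^sub>R z - y)))"
        unfolding right_diff_distrib by (subst Bochner_Integration.integral_diff) (auto intro!: int)
      also have "\<dots> \<le> (LINT z|lborel. norm (\<Psi> z * (?v (x - s *\<^sub>R S i z - y) - ?v (x - s *\<^sub>R z - y))))"
        by (rule integral_norm_bound)
      finally have "(1 + norm y) ^ N * norm (iter_partial is (\<lambda>y. g i y - u (x - y)) y)
          \<le> (1 + norm y) ^ N * (LINT z|lborel. norm (\<Psi> z * (?v (x - s *\<^sub>R S i z - y) - ?v (x - s *\<^sub>R z - y))))"
        by (rule mult_left_mono) simp
      also have "\<dots> = (LINT z|lborel. (1 + norm y) ^ N * norm (\<Psi> z * (?v (x - s *\<^sub>R S i z - y) - ?v (x - s *\<^sub>R z - y))))"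
        by simp
      also have "\<dots> \<le> (LINT z|lborel. K is * d i z)"
      proof (rule integral_mono')
        show "integrable lborel (\<lambda>z. K is * d i z)" using int_d by simp
        show "0 \<le> K is * d i z" for z using K(1) d_nonneg by simp
        show "(1 + norm y) ^ N * norm (\<Psi> z * (?v (x - s *\<^sub>R S i z - y) - ?v (x - s *\<^sub>R z - y))) \<le> K is * d i z" for z
        proof -
          have "norm (\<Psi> z) * ((1 + norm y) ^ N * norm (?v (x - s *\<^sub>R S i z - y) - ?v (x - s *\<^sub>R z - y)))
              \<le> norm (\<Psi> z) * (K is * norm ((x - s *\<^sub>R S i z) - (x - s *\<^sub>R z)) * (1 + norm (x - s *\<^sub>R S i z) + norm (x - s *\<^sub>R z)) ^ N)"
            by (intro mult_left_mono K(2)) simp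
          moreover have "(x - s *\<^sub>R S i z) - (x - s *\<^sub>R z) = s *\<^sub>R (z - S i z)"
            by (simp add: algebra_simps)
          ultimately show ?thesis
            unfolding d_def by (simp only: norm_mult mult_ac)
        qed
      qed
      also have "\<dots> = K is * (LINT z|lborel. d i z)" by simp
      finally show "(1 + norm y) ^ N * norm (iter_partial is (\<lambda>y. g i y - u (x - y)) y) \<le> K is * (LINT z|lborel. d i z)" .
    qed
    finally show ?thesis .
  qed
  have "(\<lambda>i. T (g i) - conv u T x) \<longlonglongrightarrow> 0"
  proof (rule Lim_null_comparison)
    show "\<forall>\<^sub>F i in sequentially. norm (T (g i) - conv u T x) \<le> C * (\<Sum>is | length is \<le> N. K is * (LINT z|lborel. d i z))"
      using T_le by simp
    have "(\<lambda>i. C * (\<Sum>is | length is \<le> N. K is * (LINT z|lborel. d i z))) \<longlonglongrightarrow> C * (\<Sum>is | length is \<le> N. K is * 0)"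
      by (intro tendsto_intros d_lim)
    then show "(\<lambda>i. C * (\<Sum>is | length is \<le> N. K is * (LINT z|lborel. d i z))) \<longlonglongrightarrow> 0" by simp
  qed
  then have "(\<lambda>i. LINT z|lborel. \<Psi> z * conv u T (x - s *\<^sub>R S i z)) \<longlonglongrightarrow> conv u T x"
    by (simp add: Tg LIM_zero_iff)
  \<comment> \<open>The same sequence has a second limit: \<open>conv u T\<close> is continuous, and
    its polynomial growth against the decay of \<Psi> gives the majorant.\<close>
  moreover have "(\<lambda>i. LINT z|lborel. \<Psi> z * conv u T (x - s *\<^sub>R S i z)) \<longlonglongrightarrow> (LINT z|lborel. \<Psi> z * conv u T (x - s *\<^sub>R z))"
  proof -
    obtain G M where G: "0 \<le> G" "\<And>a. norm (conv u T a) \<le> G * (1 + norm a) ^ M"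
      using conv_growth[OF T u] by blast
    show ?thesis
    proof (rule integral_dominated_convergence[where w="\<lambda>z. G * (1 + norm x + 2 * \<bar>s\<bar>) ^ M * ((1 + norm z) ^ M * norm (\<Psi> z))"])
      show "integrable lborel (\<lambda>z. G * (1 + norm x + 2 * \<bar>s\<bar>) ^ M * ((1 + norm z) ^ M * norm (\<Psi> z)))"
        by (intro integrable_mult_right schwartz_weighted_integrable \<Psi>)
      show "AE z in lborel. (\<lambda>i. \<Psi> z * conv u T (x - s *\<^sub>R S i z)) \<longlonglongrightarrow> \<Psi> z * conv u T (x - s *\<^sub>R z)"
        by (intro AE_I2 tendsto_intros isCont_tendsto_compose[OF conv_isCont[OF T u]] S_lim)
      show "AE z in lborel. norm (\<Psi> z * conv u T (x - s *\<^sub>R S i z)) \<le> G * (1 + norm x + 2 * \<bar>s\<bar>) ^ M * ((1 + norm z) ^ M * norm (\<Psi> z))" for i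
      proof (intro AE_I2)
        fix z
        have "norm (x - s *\<^sub>R S i z) \<le> norm x + \<bar>s\<bar> * (2 * norm z)"
          using norm_triangle_ineq4[of x "s *\<^sub>R S i z"] mult_left_mono[OF S_le[of i z], of "\<bar>s\<bar>"] by simp
        moreover have "(1 + norm x + 2 * \<bar>s\<bar>) * (1 + norm z) =
            1 + norm x + 2 * \<bar>s\<bar> + norm z + norm x * norm z + \<bar>s\<bar> * (2 * norm z)"
          by (simp add: algebra_simps)
        moreover have "0 \<le> norm x * norm z" "0 \<le> norm z" "0 \<le> \<bar>s\<bar>" by simp_all
        ultimately have "1 + norm (x - s *\<^sub>R S i z) \<le> (1 + norm x + 2 * \<bar>s\<bar>) * (1 + norm z)"
          by linarith
        then have "(1 + norm (x - s *\<^sub>R S i z)) ^ M \<le> (1 + norm x + 2 * \<bar>s\<bar>) ^ M * (1 + norm z) ^ M"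
          unfolding power_mult_distrib[symmetric] by (rule power_mono) simp
        then have "norm (conv u T (x - s *\<^sub>R S i z)) \<le> G * ((1 + norm x + 2 * \<bar>s\<bar>) ^ M * (1 + norm z) ^ M)"
          using G by (meson mult_left_mono order_trans)
        then have "norm (\<Psi> z) * norm (conv u T (x - s *\<^sub>R S i z)) \<le> norm (\<Psi> z) * (G * ((1 + norm x + 2 * \<bar>s\<bar>) ^ M * (1 + norm z) ^ M))"
          by (rule mult_left_mono) simp
        then show "norm (\<Psi> z * conv u T (x - s *\<^sub>R S i z)) \<le> G * (1 + norm x + 2 * \<bar>s\<bar>) ^ M * ((1 + norm z) ^ M * norm (\<Psi> z))"
          by (simp only: norm_mult mult_ac)
      qed
    qed measurable
  qed
  ultimately show ?thesis by (rule LIMSEQ_unique)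
qed

section \<open>Log-Hoelder continuity\<close>

lemma C_log_loc_isCont:
  assumes "g \<in> C_log_loc"
  shows "isCont g x"
proof -
  obtain c where c: "\<And>x y. \<bar>g x - g y\<bar> \<le> c / ln (exp 1 + 1 / norm (x - y))"
    using assms by (auto simp: C_log_loc_def)
  have "((\<lambda>y. g y - g x) \<longlongrightarrow> 0) (at x)"
  proof (rule Lim_null_comparison)
    show "\<forall>\<^sub>F y in at x. norm (g y - g x) \<le> c / ln (exp 1 + 1 / norm (y - x))"
      using c by simp
    have "filterlim (\<lambda>y. norm (y - x)) (at_right 0) (at x)"
      by (auto simp: filterlim_at eventually_at_filter intro!: tendsto_eq_intros)
    moreover have "((\<lambda>r. c / ln (exp 1 + 1 / r)) \<longlongrightarrow> 0) (at_right (0::real))"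
      by real_asymp
    ultimately show "((\<lambda>y. c / ln (exp 1 + 1 / norm (y - x))) \<longlongrightarrow> 0) (at x)"
      by (rule filterlim_compose[rotated])
  qed
  then show ?thesis by (simp add: isCont_def LIM_zero_iff)
qed

lemma C_log_loc_measurable: "g \<in> C_log_loc \<Longrightarrow> g \<in> borel_measurable borel"
  by (intro borel_measurable_continuous_onI continuous_at_imp_continuous_on ballI C_log_loc_isCont)

lemma C_log_loc_diff_cmult:
  assumes "g \<in> C_log_loc" "h \<in> C_log_loc"
  shows "(\<lambda>x. g x - k * h x) \<in> C_log_loc"
proof -
  obtain c where c: "0 < c" "\<And>x y. \<bar>g x - g y\<bar> \<le> c / ln (exp 1 + 1 / norm (x - y))"
    using assms by (auto simp: C_log_loc_def)
  obtain d where d: "0 < d" "\<And>x y. \<bar>h x - h y\<bar> \<le> d / ln (exp 1 + 1 / norm (x - y))"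
    using assms by (auto simp: C_log_loc_def)
  have "\<bar>(g x - k * h x) - (g y - k * h y)\<bar> \<le> (c + \<bar>k\<bar> * d) / ln (exp 1 + 1 / norm (x - y))" for x y
  proof -
    have "\<bar>(g x - k * h x) - (g y - k * h y)\<bar> = \<bar>(g x - g y) - k * (h x - h y)\<bar>"
      by (simp add: algebra_simps)
    also have "\<dots> \<le> \<bar>g x - g y\<bar> + \<bar>k\<bar> * \<bar>h x - h y\<bar>"
      by (rule order_trans[OF abs_triangle_ineq4]) (simp add: abs_mult)
    also have "\<dots> \<le> c / ln (exp 1 + 1 / norm (x - y)) + \<bar>k\<bar> * (d / ln (exp 1 + 1 / norm (x - y)))"
      by (intro add_mono mult_left_mono c d) simp
    finally show ?thesis by (simp add: add_divide_distrib)
  qed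
  moreover have "0 < c + \<bar>k\<bar> * d" using c(1) d(1) by (simp add: add_pos_nonneg)
  ultimately show ?thesis by (auto simp: C_log_loc_def)
qed

text \<open>The point is that \<open>1 / t \<le> (1 + r / t) * (exp 1 + 1 / r)\<close> for \<open>r = norm (x - y)\<close>, so that
  \<open>\<bar>g x - g y\<bar> * ln (1 / t)\<close> is at most \<open>c * ln (1 + r / t) + c\<close>.\<close>

lemma C_log_loc_powr_le:
  assumes "g \<in> C_log_loc"
  obtains c where "0 < c" "\<And>t x y. 0 < t \<Longrightarrow> t \<le> 1 \<Longrightarrow>
    t powr (- g x) \<le> exp c * (1 + norm (x - y) / t) powr c * t powr (- g y)"
proof -
  obtain c where c: "0 < c" "\<And>x y. \<bar>g x - g y\<bar> \<le> c / ln (exp 1 + 1 / norm (x - y))"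
    using assms by (auto simp: C_log_loc_def)
  have "t powr (- g x) \<le> exp c * (1 + norm (x - y) / t) powr c * t powr (- g y)"
    if t: "0 < t" "t \<le> 1" for t x y
  proof -
    define r where "r = norm (x - y)"
    \<comment> \<open>The claim after taking logarithms. The case \<open>x = y\<close> is separate
      because \<open>1 / r\<close> would be \<open>0\<close> by convention.\<close>
    have "- (g x - g y) * ln t \<le> c + c * ln (1 + r / t)"
    proof (cases "x = y")
      case True
      then show ?thesis using c(1) by (simp add: r_def)
    next
      case False
      then have r: "0 < r" by (simp add: r_def)
      define L where "L = ln (exp 1 + 1 / r)"
      have "ln (exp 1 :: real) \<le> L" unfolding L_def using r by (intro ln_mono) auto
      then have L: "1 \<le> L" by simp
      have pos: "0 < 1 + r / t" "0 < exp 1 + 1 / r" using r t by (auto intro!: add_pos_pos)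
      have "1 / t = (r / t) * (1 / r)" using r by simp
      also have "\<dots> \<le> (1 + r / t) * (exp 1 + 1 / r)"
        using r t by (intro mult_mono) auto
      finally have "ln (1 / t) \<le> ln ((1 + r / t) * (exp 1 + 1 / r))"
        using t by (intro ln_mono) auto
      then have le: "- ln t \<le> ln (1 + r / t) + L"
        using t pos by (simp add: ln_mult ln_div L_def)
      have l0: "0 \<le> ln (1 + r / t)" using r t by (intro ln_ge_zero) auto
      have t0: "0 \<le> - ln t" using t by simp
      have "- (g x - g y) * ln t \<le> \<bar>g x - g y\<bar> * (- ln t)"
        using mult_right_mono[OF abs_ge_self t0, of "g x - g y"] by (simp only: minus_mult_commute)
      also have "\<dots> \<le> (c / L) * (ln (1 + r / t) + L)"
        using c(2)[of x y] le t0 c(1) L by (intro mult_mono) (auto simp: r_def L_def)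
      also have "\<dots> = c + c * (ln (1 + r / t) / L)"
        using L by (simp add: field_simps)
      also have "\<dots> \<le> c + c * ln (1 + r / t)"
        using c(1) L l0 by (intro add_left_mono mult_left_mono) (auto simp: divide_le_eq mult_ge1_I mult_le_cancel_left1)
      finally show ?thesis .
    qed
    then have "- g x * ln t \<le> c + c * ln (1 + r / t) + - g y * ln t"
      by (simp add: algebra_simps)
    moreover have "0 < 1 + r / t" using t by (simp add: r_def add_pos_nonneg)
    ultimately show ?thesis
      using t unfolding r_def[symmetric] by (simp add: powr_def exp_add[symmetric])
  qed
  then show ?thesis using that c(1) by blast
qed

section \<open>Nikolskii inequality\<close>

text \<open>Since \<open>p \<ge> 1\<close>, the weighted
  modulus \<open>w\<close> in the convolution integral is at most \<open>1 + w powr p\<close>, and both terms integrate to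
  a bound that does not depend on \<open>t\<close>.\<close>

lemma nikolskii_pointwise:
  fixes \<Psi> :: "real^'n \<Rightarrow> complex" and \<beta> :: "real^'n \<Rightarrow> real"
  assumes \<Psi>: "\<Psi> \<in> schwartz" and \<beta>: "\<beta> \<in> C_log_loc"
  obtains A where "1 \<le> A" "\<And>g p t x.
    0 < t \<Longrightarrow> t \<le> 1 \<Longrightarrow> g \<in> borel_measurable borel \<Longrightarrow> p \<in> borel_measurable borel \<Longrightarrow> (\<And>x. 1 \<le> p x) \<Longrightarrow>
    (\<And>x. g x = (LINT z|lborel. \<Psi> z * g (x - (t / 4) *\<^sub>R z))) \<Longrightarrow>
    (\<integral>\<^sup>+x. ennreal ((t powr (- \<beta> x) * norm (g x)) powr p x) \<partial>lborel) \<le> ennreal (t ^ CARD('n)) \<Longrightarrow>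
    t powr (- \<beta> x) * norm (g x) \<le> A"
proof -
  note [measurable] = schwartz_measurable[OF \<Psi>] C_log_loc_measurable[OF \<beta>]
  obtain c where c: "0 < c" "\<And>t x y. 0 < t \<Longrightarrow> t \<le> 1 \<Longrightarrow>
      t powr (- \<beta> x) \<le> exp c * (1 + norm (x - y) / t) powr c * t powr (- \<beta> y)"
    using C_log_loc_powr_le[OF \<beta>] by blast
  \<comment> \<open>Rounding \<open>c\<close> up gives a natural power, to which the Schwartz bounds
    apply. \<open>K\<close> is then the kernel including the cost of moving the weight.\<close>
  define k where "k = nat \<lceil>c\<rceil>"
  define K where "K z = exp c * ((1 + norm z) ^ k * norm (\<Psi> z))" for z
  have K_nonneg: "0 \<le> K z" for z by (simp add: K_def)
  have int_K: "integrable lborel K"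
    unfolding K_def[abs_def] by (intro integrable_mult_right schwartz_weighted_integrable \<Psi>)
  then have [measurable]: "K \<in> borel_measurable borel" by auto
  obtain B where B: "0 \<le> B" "\<And>z. K z \<le> B"
  proof -
    obtain B where "0 \<le> B" "\<And>z. (1 + norm z) ^ k * norm (\<Psi> z) \<le> B"
      using schwartz_bound[OF \<Psi>] by blast
    then show ?thesis using that[of "exp c * B"] by (simp add: K_def)
  qed
  \<comment> \<open>The integral of \<open>K\<close> comes from the summand 1 in
    \<open>w \<le> 1 + w powr p\<close>, the second term from \<open>w powr p\<close>, and the last
    1 secures \<open>1 \<le> A\<close>.\<close>
  define A where "A = (LINT z|lborel. K z) + B * 4 ^ CARD('n) + 1"
  have IK: "0 \<le> (LINT z|lborel. K z)" using K_nonneg by simp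
  have "t powr (- \<beta> x) * norm (g x) \<le> A"
    if t: "0 < t" "t \<le> 1" and [measurable]: "g \<in> borel_measurable borel" "p \<in> borel_measurable borel"
      and p: "\<And>x. 1 \<le> p x"
      and rep: "\<And>x. g x = (LINT z|lborel. \<Psi> z * g (x - (t / 4) *\<^sub>R z))"
      and H1: "(\<integral>\<^sup>+x. ennreal ((t powr (- \<beta> x) * norm (g x)) powr p x) \<partial>lborel) \<le> ennreal (t ^ CARD('n))"
    for g p t x
  proof -
    define w where "w y = t powr (- \<beta> y) * norm (g y)" for y
    have w_nonneg: "0 \<le> w y" for y by (simp add: w_def)
    have [measurable]: "w \<in> borel_measurable borel" unfolding w_def[abs_def] by measurable
    define H where "H y = ennreal (w y powr p y)" for y
    have [measurable]: "H \<in> borel_measurable borel" unfolding H_def[abs_def] by measurable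
    have w_le: "ennreal (w y) \<le> 1 + H y" for y
    proof (cases "w y \<le> 1")
      case True
      then have "ennreal (w y) \<le> 1" by simp
      then show ?thesis by (rule order_trans) simp
    next
      case False
      then have "w y powr 1 \<le> w y powr p y" using p by (intro powr_mono) auto
      then have "ennreal (w y) \<le> H y" using False by (simp add: H_def ennreal_leI)
      then show ?thesis by (rule order_trans) simp
    qed
    have kernel_le: "t powr (- \<beta> x) * norm (\<Psi> z * g (x - (t / 4) *\<^sub>R z)) \<le> K z * w (x - (t / 4) *\<^sub>R z)" for z
    proof -
      let ?y = "x - (t / 4) *\<^sub>R z"
      have "(1 + norm (x - ?y) / t) powr c = (1 + norm z / 4) powr c"
        using t by simp
      also have "\<dots> \<le> (1 + norm z) powr c"
        using c(1) by (intro powr_mono2) auto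
      also have "\<dots> \<le> (1 + norm z) powr real k"
        unfolding k_def by (intro powr_mono real_nat_ceiling_ge) auto
      also have "\<dots> = (1 + norm z) ^ k"
        by (intro powr_realpow) (simp add: add_pos_nonneg)
      finally have "exp c * (1 + norm (x - ?y) / t) powr c * t powr (- \<beta> ?y) \<le> exp c * (1 + norm z) ^ k * t powr (- \<beta> ?y)"
        by (intro mult_right_mono mult_left_mono) auto
      with c(2)[OF t, of x ?y] have "t powr (- \<beta> x) \<le> exp c * (1 + norm z) ^ k * t powr (- \<beta> ?y)"
        by (rule order_trans)
      then have "t powr (- \<beta> x) * (norm (\<Psi> z) * norm (g ?y)) \<le>
          exp c * (1 + norm z) ^ k * t powr (- \<beta> ?y) * (norm (\<Psi> z) * norm (g ?y))"
        by (rule mult_right_mono) simp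
      then show ?thesis by (simp add: K_def w_def norm_mult mult_ac)
    qed
    \<comment> \<open>The substitution has Jacobian \<open>(t / 4) ^ CARD('n)\<close>, and the
      assumed bound \<open>t ^ CARD('n)\<close> cancels its dependence on \<open>t\<close>.\<close>
    have J: "(\<integral>\<^sup>+z. H (x - (t / 4) *\<^sub>R z) \<partial>lborel) \<le> ennreal (4 ^ CARD('n))"
    proof -
      have "(\<integral>\<^sup>+y. H y \<partial>lborel) = ennreal ((t / 4) ^ CARD('n)) * (\<integral>\<^sup>+z. H (x - (t / 4) *\<^sub>R z) \<partial>lborel)"
        using nn_integral_lborel_affine[of H "- (t / 4)" x] t by simp
      then have "ennreal ((t / 4) ^ CARD('n)) * (\<integral>\<^sup>+z. H (x - (t / 4) *\<^sub>R z) \<partial>lborel) \<le> ennreal (t ^ CARD('n))"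
        using H1 by (simp add: H_def w_def)
      then have "ennreal ((4 / t) ^ CARD('n)) * (ennreal ((t / 4) ^ CARD('n)) * (\<integral>\<^sup>+z. H (x - (t / 4) *\<^sub>R z) \<partial>lborel))
          \<le> ennreal ((4 / t) ^ CARD('n)) * ennreal (t ^ CARD('n))"
        by (rule mult_left_mono) simp
      also have "ennreal ((4 / t) ^ CARD('n)) * ennreal (t ^ CARD('n)) = ennreal (4 ^ CARD('n))"
        using t by (simp add: ennreal_mult[symmetric] power_mult_distrib[symmetric])
      also have "ennreal ((4 / t) ^ CARD('n)) * (ennreal ((t / 4) ^ CARD('n)) * (\<integral>\<^sup>+z. H (x - (t / 4) *\<^sub>R z) \<partial>lborel)) =
          (\<integral>\<^sup>+z. H (x - (t / 4) *\<^sub>R z) \<partial>lborel)"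
        using t by (simp add: mult.assoc[symmetric] ennreal_mult[symmetric] power_mult_distrib[symmetric])
      finally show ?thesis .
    qed
    \<comment> \<open>If the integrand were not integrable, its integral would be 0 by convention
      and \<open>g x = 0\<close>, so the bound holds in either case.\<close>
    have "ennreal (norm (g x)) \<le> (\<integral>\<^sup>+z. ennreal (norm (\<Psi> z * g (x - (t / 4) *\<^sub>R z))) \<partial>lborel)"
    proof (cases "integrable lborel (\<lambda>z. \<Psi> z * g (x - (t / 4) *\<^sub>R z))")
      case True
      then show ?thesis by (subst rep) (rule integral_norm_bound_ennreal)
    next
      case False
      then show ?thesis by (subst rep) (simp add: not_integrable_integral_eq)
    qed
    then have "ennreal (t powr (- \<beta> x)) * ennreal (norm (g x)) \<le>
        ennreal (t powr (- \<beta> x)) * (\<integral>\<^sup>+z. ennreal (norm (\<Psi> z * g (x - (t / 4) *\<^sub>R z))) \<partial>lborel)"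
      by (rule mult_left_mono) simp
    also have "\<dots> = (\<integral>\<^sup>+z. ennreal (t powr (- \<beta> x)) * ennreal (norm (\<Psi> z * g (x - (t / 4) *\<^sub>R z))) \<partial>lborel)"
      by (rule nn_integral_cmult[symmetric]) measurable
    also have "\<dots> \<le> (\<integral>\<^sup>+z. ennreal (K z) + ennreal B * H (x - (t / 4) *\<^sub>R z) \<partial>lborel)"
    proof (rule nn_integral_mono)
      fix z
      let ?y = "x - (t / 4) *\<^sub>R z"
      have "ennreal (t powr (- \<beta> x)) * ennreal (norm (\<Psi> z * g ?y)) \<le> ennreal (K z) * ennreal (w ?y)"
        using kernel_le[of z] K_nonneg w_nonneg by (simp add: ennreal_mult[symmetric] ennreal_leI)
      also have "\<dots> \<le> ennreal (K z) * (1 + H ?y)"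
        by (intro mult_left_mono w_le) simp
      also have "\<dots> = ennreal (K z) + ennreal (K z) * H ?y"
        by (simp add: distrib_left)
      also have "\<dots> \<le> ennreal (K z) + ennreal B * H ?y"
        by (intro add_left_mono mult_right_mono ennreal_leI B) simp
      finally show "ennreal (t powr (- \<beta> x)) * ennreal (norm (\<Psi> z * g ?y)) \<le> ennreal (K z) + ennreal B * H ?y" .
    qed
    also have "\<dots> = (\<integral>\<^sup>+z. ennreal (K z) \<partial>lborel) + ennreal B * (\<integral>\<^sup>+z. H (x - (t / 4) *\<^sub>R z) \<partial>lborel)"
      by (subst nn_integral_add) (auto simp: nn_integral_cmult)
    also have "\<dots> \<le> ennreal (LINT z|lborel. K z) + ennreal B * ennreal (4 ^ CARD('n))"
      using nn_integral_eq_integral[OF int_K] K_nonneg by (intro add_mono mult_left_mono J) auto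
    also have "\<dots> = ennreal ((LINT z|lborel. K z) + B * 4 ^ CARD('n))"
      using IK B(1) by (simp add: ennreal_mult[symmetric] ennreal_plus[symmetric] del: ennreal_plus)
    finally have "ennreal (t powr (- \<beta> x) * norm (g x)) \<le> ennreal ((LINT z|lborel. K z) + B * 4 ^ CARD('n))"
      by (simp add: ennreal_mult)
    then have "t powr (- \<beta> x) * norm (g x) \<le> (LINT z|lborel. K z) + B * 4 ^ CARD('n)"
      using IK B(1) by (subst (asm) ennreal_le_iff) auto
    then show ?thesis by (simp add: A_def)
  qed
  moreover have "1 \<le> A" using IK B(1) by (simp add: A_def)
  ultimately show ?thesis using that by blast
qed

text \<open>Every \<open>l\<close> admissible for \<open>f\<close> makes \<open>A * l\<close>
  admissible for \<open>h\<close>. Moving \<open>1 / A\<close> to the left leaves a lower bound for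
  an infimum, which also covers the infinite norm. It serves both the inner norms in space and the
  outer norm in \<open>t\<close>.\<close>

lemma luxemburg_norm_le_cmult:
  assumes A: "0 < A"
    and le: "\<And>l. 0 < l \<Longrightarrow> (\<integral>\<^sup>+x. epowr (f x / ennreal l) (p x) \<partial>M) \<le> 1 \<Longrightarrow>
      (\<integral>\<^sup>+x. epowr (h x / ennreal (A * l)) (q x) \<partial>N) \<le> 1"
  shows "luxemburg_norm N q h \<le> ennreal A * luxemburg_norm M p f"
proof -
  have "ennreal (1 / A) * luxemburg_norm N q h \<le> luxemburg_norm M p f"
    unfolding luxemburg_norm_def[of M]
  proof (rule INF_greatest)
    fix l assume "l \<in> {l::real. 0 < l \<and> (\<integral>\<^sup>+x. epowr (f x / ennreal l) (p x) \<partial>M) \<le> 1}"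
    then have l: "0 < l" "(\<integral>\<^sup>+x. epowr (f x / ennreal l) (p x) \<partial>M) \<le> 1" by auto
    have "luxemburg_norm N q h \<le> ennreal (A * l)"
      unfolding luxemburg_norm_def by (rule INF_lower) (use A l le in auto)
    then have "ennreal (1 / A) * luxemburg_norm N q h \<le> ennreal (1 / A) * ennreal (A * l)"
      by (rule mult_left_mono) simp
    also have "\<dots> = ennreal l" using A l by (simp add: ennreal_mult[symmetric])
    finally show "ennreal (1 / A) * luxemburg_norm N q h \<le> ennreal l" .
  qed
  then have "ennreal A * (ennreal (1 / A) * luxemburg_norm N q h) \<le> ennreal A * luxemburg_norm M p f"
    by (rule mult_left_mono) simp
  then show ?thesis
    using A by (simp add: mult.assoc[symmetric] ennreal_mult[symmetric])
qed

section \<open>Comparison of weighted variable Lebesgue norms at a fixed scale\<close>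

lemma epowr_ennreal: "0 \<le> a \<Longrightarrow> epowr (ennreal a) b = ennreal (a powr b)"
  by (simp add: epowr_def)

lemma epowr_mono:
  assumes "x \<le> y" "0 \<le> a"
  shows "epowr x a \<le> epowr y a"
proof (cases "y = \<infinity>")
  case False
  then have "x \<noteq> \<infinity>" "enn2real x \<le> enn2real y"
    using assms(1) by (auto simp: top_unique intro!: enn2real_mono simp: less_top)
  then show ?thesis
    using False assms(2) by (simp add: epowr_def ennreal_leI powr_mono2)
qed (simp add: epowr_def)

text \<open>Both weights reduce to the same \<beta>, so the two modular integrands can be compared
  pointwise once the normalised \<open>t powr (- \<beta> x) * norm (g x)\<close> is bounded. That
  \<open>A\<close> is chosen before \<open>g\<close> and \<open>t\<close> makes the result usable
  under the outer norm.\<close>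

lemma Lp_norm_nikolskii:
  fixes \<Psi> :: "real^'n \<Rightarrow> complex" and \<alpha>\<^sub>0 \<alpha>\<^sub>1 p\<^sub>0 p\<^sub>1 :: "real^'n \<Rightarrow> real"
  assumes \<Psi>: "\<Psi> \<in> schwartz" and \<alpha>0: "\<alpha>\<^sub>0 \<in> C_log_loc"
    and p0: "(\<lambda>x. 1 / p\<^sub>0 x) \<in> C_log_loc" "\<And>x. 1 \<le> p\<^sub>0 x" and p1: "\<And>x. 1 \<le> p\<^sub>1 x"
    and le: "\<And>x. \<alpha>\<^sub>1 x \<le> \<alpha>\<^sub>0 x"
    and eq: "\<And>x. \<alpha>\<^sub>0 x - real CARD('n) / p\<^sub>0 x = \<alpha>\<^sub>1 x - real CARD('n) / p\<^sub>1 x"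
  obtains A where "1 \<le> A" "\<And>g t. 0 < t \<Longrightarrow> t \<le> 1 \<Longrightarrow> g \<in> borel_measurable borel \<Longrightarrow>
    (\<And>x. g x = (LINT z|lborel. \<Psi> z * g (x - (t / 4) *\<^sub>R z))) \<Longrightarrow>
    Lp_norm p\<^sub>1 (\<lambda>x. (t powr (- \<alpha>\<^sub>1 x)) *\<^sub>R g x) \<le> ennreal A * Lp_norm p\<^sub>0 (\<lambda>x. (t powr (- \<alpha>\<^sub>0 x)) *\<^sub>R g x)"
proof -
  let ?n = "real CARD('n)"
  define \<beta> where "\<beta> x = \<alpha>\<^sub>0 x - ?n * (1 / p\<^sub>0 x)" for x
  have \<beta>: "\<beta> \<in> C_log_loc"
    unfolding \<beta>_def[abs_def] by (rule C_log_loc_diff_cmult[OF \<alpha>0 p0(1)])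
  \<comment> \<open>Borel measurability comes from the continuity of the reciprocal.\<close>
  have p0_meas[measurable]: "p\<^sub>0 \<in> borel_measurable borel"
  proof -
    have "(\<lambda>x. 1 / (1 / p\<^sub>0 x)) \<in> borel_measurable borel"
      using C_log_loc_measurable[OF p0(1)] by measurable
    then show ?thesis by simp
  qed
  note [measurable] = C_log_loc_measurable[OF \<alpha>0] C_log_loc_measurable[OF \<beta>]
  have p0_pos: "0 < p\<^sub>0 x" and p1_pos: "0 < p\<^sub>1 x" for x
    using p0(2)[of x] p1[of x] by auto
  \<comment> \<open>The gap \<open>\<alpha>\<^sub>0 - \<alpha>\<^sub>1 \<ge> 0\<close> equals
    \<open>?n / p\<^sub>0 - ?n / p\<^sub>1\<close>.\<close>
  have p_le: "p\<^sub>0 x \<le> p\<^sub>1 x" for x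
  proof -
    have "?n / p\<^sub>1 x \<le> ?n / p\<^sub>0 x" using eq[of x] le[of x] by linarith
    then show ?thesis using p0_pos[of x] p1_pos[of x] by (simp add: field_simps)
  qed
  obtain A where A: "1 \<le> A" and point: "\<And>g p t x.
    0 < t \<Longrightarrow> t \<le> 1 \<Longrightarrow> g \<in> borel_measurable borel \<Longrightarrow> p \<in> borel_measurable borel \<Longrightarrow> (\<And>x. 1 \<le> p x) \<Longrightarrow>
    (\<And>x. g x = (LINT z|lborel. \<Psi> z * g (x - (t / 4) *\<^sub>R z))) \<Longrightarrow>
    (\<integral>\<^sup>+x. ennreal ((t powr (- \<beta> x) * norm (g x)) powr p x) \<partial>lborel) \<le> ennreal (t ^ CARD('n)) \<Longrightarrow>
    t powr (- \<beta> x) * norm (g x) \<le> A"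
    using nikolskii_pointwise[OF \<Psi> \<beta>] by blast
  have "Lp_norm p\<^sub>1 (\<lambda>x. (t powr (- \<alpha>\<^sub>1 x)) *\<^sub>R g x) \<le> ennreal A * Lp_norm p\<^sub>0 (\<lambda>x. (t powr (- \<alpha>\<^sub>0 x)) *\<^sub>R g x)"
    if t: "0 < t" "t \<le> 1" and g[measurable]: "g \<in> borel_measurable borel"
      and rep: "\<And>x. g x = (LINT z|lborel. \<Psi> z * g (x - (t / 4) *\<^sub>R z))" for g t
    unfolding Lp_norm_def
  proof (rule luxemburg_norm_le_cmult)
    show "0 < A" using A by simp
    fix l :: real assume l: "0 < l"
    define v where "v x = norm (g x) / l" for x
    have v0: "0 \<le> v x" for x using l by (simp add: v_def)
    have [measurable]: "v \<in> borel_measurable borel" unfolding v_def[abs_def] by measurable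
    have e0: "epowr (ennreal (norm ((t powr (- \<alpha>\<^sub>0 x)) *\<^sub>R g x)) / ennreal l) (p\<^sub>0 x) =
        ennreal ((t powr (- \<alpha>\<^sub>0 x) * v x) powr p\<^sub>0 x)" for x
      using l by (simp add: divide_ennreal epowr_ennreal v_def)
    have e1: "epowr (ennreal (norm ((t powr (- \<alpha>\<^sub>1 x)) *\<^sub>R g x)) / ennreal (A * l)) (p\<^sub>1 x) =
        ennreal ((t powr (- \<alpha>\<^sub>1 x) * v x / A) powr p\<^sub>1 x)" for x
      using l A by (simp add: divide_ennreal epowr_ennreal v_def field_simps)
    \<comment> \<open>Replacing \<open>\<alpha>\<^sub>0\<close> by \<beta> costs the factor
      \<open>t powr (?n / p\<^sub>0 x)\<close>, whose power with exponent \<open>p\<^sub>0 x\<close>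
      is \<open>t ^ CARD('n)\<close> at every \<open>x\<close>. The next identity is the analogue
      for \<open>p\<^sub>1\<close>.\<close>
    have w_p0: "(t powr (- \<beta> x) * v x) powr p\<^sub>0 x = t ^ CARD('n) * (t powr (- \<alpha>\<^sub>0 x) * v x) powr p\<^sub>0 x" for x
    proof -
      have "t powr (- \<beta> x) * v x = t powr (?n / p\<^sub>0 x) * (t powr (- \<alpha>\<^sub>0 x) * v x)"
        by (simp add: \<beta>_def powr_add[symmetric] mult.assoc[symmetric])
      then have "(t powr (- \<beta> x) * v x) powr p\<^sub>0 x =
          (t powr (?n / p\<^sub>0 x)) powr p\<^sub>0 x * (t powr (- \<alpha>\<^sub>0 x) * v x) powr p\<^sub>0 x"
        by (simp only: powr_mult)
      also have "(t powr (?n / p\<^sub>0 x)) powr p\<^sub>0 x = t ^ CARD('n)"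
        using t p0_pos[of x, THEN less_imp_neq] by (simp add: powr_powr powr_realpow)
      finally show ?thesis .
    qed
    have w_p1: "(t powr (- \<alpha>\<^sub>1 x) * v x / A) powr p\<^sub>1 x = (1 / t ^ CARD('n)) * (t powr (- \<beta> x) * v x / A) powr p\<^sub>1 x" for x
    proof -
      have "- \<alpha>\<^sub>1 x = - (?n / p\<^sub>1 x) + - \<beta> x" using eq[of x] by (simp add: \<beta>_def)
      then have "t powr (- \<alpha>\<^sub>1 x) * v x / A = t powr (- (?n / p\<^sub>1 x)) * (t powr (- \<beta> x) * v x / A)"
        by (simp only: powr_add mult.assoc times_divide_eq_right)
      then have "(t powr (- \<alpha>\<^sub>1 x) * v x / A) powr p\<^sub>1 x =
          (t powr (- (?n / p\<^sub>1 x))) powr p\<^sub>1 x * (t powr (- \<beta> x) * v x / A) powr p\<^sub>1 x"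
        by (simp only: powr_mult)
      also have "(t powr (- (?n / p\<^sub>1 x))) powr p\<^sub>1 x = 1 / t ^ CARD('n)"
        using t p1_pos[of x, THEN less_imp_neq] unfolding powr_powr by (simp add: powr_minus_divide powr_realpow)
      finally show ?thesis .
    qed
    assume "(\<integral>\<^sup>+x. epowr (ennreal (norm ((t powr (- \<alpha>\<^sub>0 x)) *\<^sub>R g x)) / ennreal l) (p\<^sub>0 x) \<partial>lebesgue) \<le> 1"
    then have le1: "(\<integral>\<^sup>+x. ennreal ((t powr (- \<alpha>\<^sub>0 x) * v x) powr p\<^sub>0 x) \<partial>lborel) \<le> 1"
      by (simp only: e0 nn_integral_completion)
    have "(\<integral>\<^sup>+x. ennreal ((t powr (- \<beta> x) * v x) powr p\<^sub>0 x) \<partial>lborel) =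
        (\<integral>\<^sup>+x. ennreal (t ^ CARD('n)) * ennreal ((t powr (- \<alpha>\<^sub>0 x) * v x) powr p\<^sub>0 x) \<partial>lborel)"
      using t by (simp add: w_p0 ennreal_mult)
    also have "\<dots> = ennreal (t ^ CARD('n)) * (\<integral>\<^sup>+x. ennreal ((t powr (- \<alpha>\<^sub>0 x) * v x) powr p\<^sub>0 x) \<partial>lborel)"
      by (rule nn_integral_cmult) measurable
    also have "\<dots> \<le> ennreal (t ^ CARD('n)) * 1"
      by (intro mult_left_mono le1) simp
    finally have le2: "(\<integral>\<^sup>+x. ennreal ((t powr (- \<beta> x) * v x) powr p\<^sub>0 x) \<partial>lborel) \<le> ennreal (t ^ CARD('n))"
      by simp
    have w_le: "t powr (- \<beta> x) * v x \<le> A" for x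
    proof -
      have v_eq: "norm (g x / of_real l) = v x" for x
        using l by (simp add: v_def norm_divide)
      \<comment> \<open>The pointwise bound is applied to \<open>g\<close> divided by
        \<open>l\<close>, which inherits the reproducing formula by linearity and has the required
        modular bound.\<close>
      have "t powr (- \<beta> x) * norm (g x / of_real l) \<le> A"
      proof (rule point[OF t _ p0_meas p0(2)])
        show "(\<lambda>x. g x / of_real l) \<in> borel_measurable borel" by measurable
        show "g x / of_real l = (LINT z|lborel. \<Psi> z * (g (x - (t / 4) *\<^sub>R z) / of_real l))" for x
          by (subst rep) simp
        show "(\<integral>\<^sup>+x. ennreal ((t powr (- \<beta> x) * norm (g x / of_real l)) powr p\<^sub>0 x) \<partial>lborel) \<le> ennreal (t ^ CARD('n))"
          using le2 by (simp only: v_eq)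
      qed
      then show ?thesis by (simp only: v_eq)
    qed
    \<comment> \<open>As \<open>?w / A \<le> 1\<close>, the larger exponent
      \<open>p\<^sub>1 x\<close> gives the smaller power; then \<open>1 \<le> A\<close> removes the
      division.\<close>
    have "(t powr (- \<alpha>\<^sub>1 x) * v x / A) powr p\<^sub>1 x \<le> (t powr (- \<alpha>\<^sub>0 x) * v x) powr p\<^sub>0 x" for x
    proof -
      let ?w = "t powr (- \<beta> x) * v x"
      have "(?w / A) powr p\<^sub>1 x \<le> (?w / A) powr p\<^sub>0 x"
        using w_le[of x] A v0[of x] p_le[of x] by (intro powr_mono') auto
      also have "\<dots> \<le> ?w powr p\<^sub>0 x"
        using A v0[of x] p0_pos[of x] divide_left_mono[of 1 A ?w] by (intro powr_mono2) auto
      finally have "(1 / t ^ CARD('n)) * (?w / A) powr p\<^sub>1 x \<le> (1 / t ^ CARD('n)) * ?w powr p\<^sub>0 x"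
        using t by (intro mult_left_mono) auto
      then show ?thesis using t by (simp add: w_p0 w_p1)
    qed
    then have "(\<integral>\<^sup>+x. ennreal ((t powr (- \<alpha>\<^sub>1 x) * v x / A) powr p\<^sub>1 x) \<partial>lborel) \<le>
        (\<integral>\<^sup>+x. ennreal ((t powr (- \<alpha>\<^sub>0 x) * v x) powr p\<^sub>0 x) \<partial>lborel)"
      by (intro nn_integral_mono ennreal_leI)
    also note le1
    finally show "(\<integral>\<^sup>+x. epowr (ennreal (norm ((t powr (- \<alpha>\<^sub>1 x)) *\<^sub>R g x)) / ennreal (A * l)) (p\<^sub>1 x) \<partial>lebesgue) \<le> 1"
      by (simp only: e1 nn_integral_completion)
  qed
  then show ?thesis using that A by blast
qed

section \<open>Dilated kernels and the embedding\<close>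

lemma schwartz_dilate:
  fixes \<phi> :: "real^'n \<Rightarrow> complex"
  assumes "\<phi> \<in> schwartz" "0 < t"
  shows "dilate t \<phi> \<in> schwartz"
proof -
  have eq: "dilate t \<phi> = (\<lambda>y. of_real (1 / t ^ CARD('n)) * \<phi> (0 + inverse t *\<^sub>R y))"
    by (simp add: fun_eq_iff dilate_def scaleR_conv_of_real)
  show ?thesis
    unfolding eq by (rule schwartz_affine[OF assms(1)]) (use assms(2) in simp)
qed

text \<open>Dilation by \<open>t\<close> multiplies the scale of the formula by \<open>t\<close> and
  leaves the kernel \<Phi> fixed; this turns \<open>1 / 4\<close> into \<open>t / 4\<close> with one
  kernel for all \<open>t\<close>.\<close>

lemma dilate_reproducing:
  fixes \<phi> :: "real^'n \<Rightarrow> complex"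
  assumes rep: "\<And>y. \<phi> y = (LINT z|lborel. \<Phi> z * \<phi> (y - s *\<^sub>R z))" and t: "0 < t"
  shows "dilate t \<phi> y = (LINT z|lborel. \<Phi> z * dilate t \<phi> (y - (t * s) *\<^sub>R z))"
proof -
  have "(y - (t * s) *\<^sub>R z) /\<^sub>R t = y /\<^sub>R t - s *\<^sub>R z" for z :: "real^'n"
    using t by (simp add: algebra_simps)
  then show ?thesis
    unfolding dilate_def by (subst rep) simp
qed

theorem theorem8:
  fixes \<alpha>\<^sub>0 \<alpha>\<^sub>1 p\<^sub>0 p\<^sub>1 :: "real^'n \<Rightarrow> real" and q :: "real \<Rightarrow> real"
    and \<Phi> \<phi> :: "real^'n \<Rightarrow> complex"
  assumes "resolution_of_unity \<Phi> \<phi>"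
    and "\<alpha>\<^sub>0 \<in> C_log_loc" and "\<alpha>\<^sub>1 \<in> C_log_loc"
    and "p\<^sub>0 \<in> log_exponents" and "p\<^sub>1 \<in> log_exponents"
    and "q \<in> exponents" and "log_holder_at_origin q"
    and "\<forall>x. \<alpha>\<^sub>1 x \<le> \<alpha>\<^sub>0 x"
    and "\<forall>x. \<alpha>\<^sub>0 x - real CARD('n) / p\<^sub>0 x = \<alpha>\<^sub>1 x - real CARD('n) / p\<^sub>1 x"
  shows "embeds (besov_space \<Phi> \<phi> \<alpha>\<^sub>0 p\<^sub>0 q) (besov_norm \<Phi> \<phi> \<alpha>\<^sub>0 p\<^sub>0 q)
                (besov_space \<Phi> \<phi> \<alpha>\<^sub>1 p\<^sub>1 q) (besov_norm \<Phi> \<phi> \<alpha>\<^sub>1 p\<^sub>1 q)"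
proof -
  note R = assms(1)
  have \<Phi>: "\<Phi> \<in> schwartz" and \<phi>: "\<phi> \<in> schwartz"
    and supp: "supp (fourier \<Phi>) \<subseteq> {\<xi>. norm \<xi> < 2}" "supp (fourier \<phi>) \<subseteq> {\<xi>. norm \<xi> < 2}"
    using R unfolding resolution_of_unity_def by auto
  have p0: "(\<lambda>x. 1 / p\<^sub>0 x) \<in> C_log_loc" "\<And>x. 1 \<le> p\<^sub>0 x" and p1: "\<And>x. 1 \<le> p\<^sub>1 x"
    using assms(4,5) by (auto simp: log_exponents_def C_log_def exponents_def)
  have q: "0 \<le> q x" for x
    using assms(6) by (auto simp: exponents_def intro: order_trans[of 0 1])
  obtain A where A: "1 \<le> A" and nik: "\<And>g t. 0 < t \<Longrightarrow> t \<le> 1 \<Longrightarrow> g \<in> borel_measurable borel \<Longrightarrow>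
    (\<And>x. g x = (LINT z|lborel. \<Phi> z * g (x - (t / 4) *\<^sub>R z))) \<Longrightarrow>
    Lp_norm p\<^sub>1 (\<lambda>x. (t powr (- \<alpha>\<^sub>1 x)) *\<^sub>R g x) \<le> ennreal A * Lp_norm p\<^sub>0 (\<lambda>x. (t powr (- \<alpha>\<^sub>0 x)) *\<^sub>R g x)"
    using Lp_norm_nikolskii[OF \<Phi> assms(2) p0 p1 assms(8)[rule_format] assms(9)[rule_format]] by blast
  have norm_le: "besov_norm \<Phi> \<phi> \<alpha>\<^sub>1 p\<^sub>1 q f \<le> ennreal A * besov_norm \<Phi> \<phi> \<alpha>\<^sub>0 p\<^sub>0 q f" if f: "f \<in> tempered" for f
  proof -
    \<comment> \<open>At \<open>t = 1\<close> both weights equal 1, so the same inequality covers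
      the low-frequency term.\<close>
    have low: "Lp_norm p\<^sub>1 (conv \<Phi> f) \<le> ennreal A * Lp_norm p\<^sub>0 (conv \<Phi> f)"
      using nik[of 1 "conv \<Phi> f", OF _ _ conv_measurable[OF f \<Phi>]
          conv_reproducing[OF f \<Phi> \<Phi> band_limited_reproducing[OF R \<Phi> supp(1)]]]
      by simp
    have high: "Lp_norm p\<^sub>1 (\<lambda>x. (t powr (- \<alpha>\<^sub>1 x)) *\<^sub>R conv (dilate t \<phi>) f x) \<le>
        ennreal A * Lp_norm p\<^sub>0 (\<lambda>x. (t powr (- \<alpha>\<^sub>0 x)) *\<^sub>R conv (dilate t \<phi>) f x)"
      if t: "0 < t" "t \<le> 1" for t
    proof (rule nik[OF t])
      note d = schwartz_dilate[OF \<phi> t(1)]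
      show "conv (dilate t \<phi>) f \<in> borel_measurable borel" by (rule conv_measurable[OF f d])
      show "conv (dilate t \<phi>) f x = (LINT z|lborel. \<Phi> z * conv (dilate t \<phi>) f (x - (t / 4) *\<^sub>R z))" for x
        using conv_reproducing[OF f d \<Phi> dilate_reproducing[OF band_limited_reproducing[OF R \<phi> supp(2)] t(1)], of x]
        unfolding times_divide_eq_right mult_1_right .
    qed
    have "luxemburg_norm log_measure q (\<lambda>t. Lp_norm p\<^sub>1 (\<lambda>x. (t powr (- \<alpha>\<^sub>1 x)) *\<^sub>R conv (dilate t \<phi>) f x))
        \<le> ennreal A * luxemburg_norm log_measure q (\<lambda>t. Lp_norm p\<^sub>0 (\<lambda>x. (t powr (- \<alpha>\<^sub>0 x)) *\<^sub>R conv (dilate t \<phi>) f x))"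
      (is "luxemburg_norm _ _ ?N1 \<le> _ * luxemburg_norm _ _ ?N0")
    proof (rule luxemburg_norm_le_cmult)
      show "0 < A" using A by simp
      fix l :: real assume l: "0 < l" and le1: "(\<integral>\<^sup>+t. epowr (?N0 t / ennreal l) (q t) \<partial>log_measure) \<le> 1"
      \<comment> \<open>One constant \<open>A\<close> works for every \<open>t\<close> in the unit
        interval and cancels against the \<open>A\<close> in \<open>A * l\<close>, so the integrands
        are already ordered pointwise.\<close>
      have "(\<integral>\<^sup>+t. epowr (?N1 t / ennreal (A * l)) (q t) \<partial>log_measure) \<le> (\<integral>\<^sup>+t. epowr (?N0 t / ennreal l) (q t) \<partial>log_measure)"
      proof (intro nn_integral_mono epowr_mono q)
        fix t assume "t \<in> space log_measure"
        then have t: "0 < t" "t \<le> 1" by (auto simp: log_measure_def)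
        have "?N1 t / ennreal (A * l) \<le> ennreal A * ?N0 t / ennreal (A * l)"
          by (rule divide_right_mono_ennreal[OF high[OF t]])
        also have "\<dots> = ?N0 t / ennreal l"
          using A l by (simp add: ennreal_mult mult.commute[of "ennreal A"] divide_mult_eq)
        finally show "?N1 t / ennreal (A * l) \<le> ?N0 t / ennreal l" .
      qed
      also note le1
      finally show "(\<integral>\<^sup>+t. epowr (?N1 t / ennreal (A * l)) (q t) \<partial>log_measure) \<le> 1" .
    qed
    with low show ?thesis
      unfolding besov_norm_def distrib_left by (rule add_mono)
  qed
  have "besov_space \<Phi> \<phi> \<alpha>\<^sub>0 p\<^sub>0 q \<subseteq> besov_space \<Phi> \<phi> \<alpha>\<^sub>1 p\<^sub>1 q"
  proof
    fix f assume "f \<in> besov_space \<Phi> \<phi> \<alpha>\<^sub>0 p\<^sub>0 q"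
    then have f: "f \<in> tempered" "besov_norm \<Phi> \<phi> \<alpha>\<^sub>0 p\<^sub>0 q f < \<infinity>" by (auto simp: besov_space_def)
    then have "ennreal A * besov_norm \<Phi> \<phi> \<alpha>\<^sub>0 p\<^sub>0 q f < \<infinity>" by (simp add: ennreal_mult_less_top)
    then show "f \<in> besov_space \<Phi> \<phi> \<alpha>\<^sub>1 p\<^sub>1 q"
      using f norm_le[OF f(1)] by (auto simp: besov_space_def)
  qed
  moreover have "\<forall>f\<in>besov_space \<Phi> \<phi> \<alpha>\<^sub>0 p\<^sub>0 q. besov_norm \<Phi> \<phi> \<alpha>\<^sub>1 p\<^sub>1 q f \<le> ennreal A * besov_norm \<Phi> \<phi> \<alpha>\<^sub>0 p\<^sub>0 q f"
    using norm_le by (auto simp: besov_space_def)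
  ultimately show ?thesis
    unfolding embeds_def using A by (intro conjI exI[of _ A]) auto
qed

end
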